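(* Let $H=\bigoplus_{i=1}^m H_i$ be the direct sum of separable real Hilbert spaces $H_1,\dots,H_m$, let $f\colon H\to\mathbb{R}$ be convex and differentiable, let $h_i\colon H_i\to\,]-\infty,+\infty]$ be proper, convex and lower semicontinuous for $i=1,\dots,m$, and set $h(x)=\sum_{i=1}^m h_i(x_i)$ and $F=f+h$. Let $\varepsilon=(\varepsilon_1,\dots,\varepsilon_m)$ be a $\{0,1\}^m$-valued random variable with $p_i:=\mathsf{P}(\varepsilon_i=1)>0$ for every $i$ and $\mathsf{P}(\varepsilon=(0,\dots,0))=0$, and let $(\varepsilon^n)_{n\in\mathbb{N}}$ be a sequence of independent copies of $\varepsilon$. Let $(\nu_i)_{1\le i\le m}\in\,]0,+\infty[^m$ be such that $$(\forall x,v\in H)\quad \mathsf{E}[f(x+\varepsilon\odot v)]\le f(x)+\mathsf{E}[\langle\nabla f(x),\varepsilon\odot v\rangle]+\frac12\sum_{i=1}^m p_i\nu_i\|v_i\|^2 .$$ Let $0<\gamma_i<2/\nu_i$ for every $i\in\{1,\dots,m\}$ and let $x^0\in\operatorname{dom}h$ be deterministic. Set $\delta=\max_{i}\gamma_i\nu_i$, $p_{\min}=\min_{i}p_i$, $F_*=\inf F$ and $S_*=\operatorname{argmin}F$. Suppose that $S_*\neq\varnothing$ and that there is a constant $c>0$ such that, for every $x\in X:=\{x\in H\mid F(x)\le F(x^0)\}$, $$\mathrm{dist}_{\Gamma^{-1}}(x,S_* )\le c\,\big\|x-\big(\mathrm{prox}_{\gamma_ih_i}(x_i-\gamma_i\nabla_if(x))\big)_{1\le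 i\le m}\big\|_{\Gamma^{-1}} .$$ Let $(x^n)_{n\in\mathbb{N}}$ be the sequence of $H$-valued random variables generated, from $x^0$, as follows: for every $n\in\mathbb{N}$, set $$\tilde x_i^{n+1}=x_i^n+\varepsilon_i^n\big(\mathrm{prox}_{\gamma_i h_i}(x_i^n-\gamma_i\nabla_i f(x^n))-x_i^n\big),\qquad i=1,\dots,m,$$ and let $x^{n+1}=\tilde x^{n+1}$ if $F(\tilde x^{n+1})\le F(x^n)$, and $x^{n+1}=x^n$ otherwise. Then, for every $n\in\mathbb{N}$, $$\mathsf{E}[F(x^n)]-F_*\le\Big(1-p_{\min}\min\Big\{1,\frac{2-\delta}{2c}\Big\}\Big)^n\big(\mathsf{E}[F(x^0)]-F_*\big).$$ Moreover, there exists a random variable $x_*$ taking values in $S_*$ such that $x^n\to x_*$ (strongly) $\mathsf{P}$-a.s. and $$\mathsf{E}[\|x^n-x_*\|_W]=O\Big(\big(1-p_{\min}\min\{1,(2-\delta)/(2c)\}\big)^{n/2}\Big).$$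
   Context: $H=\bigoplus_i H_i$ carries the inner product $\langle x,y\rangle=\sum_{i=1}^m\langle x_i,y_i\rangle$; $\nabla_i f(x)\in H_i$ is the $i$-th component of $\nabla f(x)$. For $v\in H$ and $\epsilon\in\{0,1\}^m$, $\epsilon\odot v=(\epsilon_iv_i)_{1\le i\le m}\in H$. For a proper convex lower semicontinuous function $\varphi$ on a Hilbert space, $\mathrm{prox}_\varphi(x)=\operatorname{argmin}_z\ \varphi(z)+\frac12\|x-z\|^2$. The weighted norms are $\|x\|_{\Gamma^{-1}}^2=\sum_{i=1}^m\frac1{\gamma_i}\|x_i\|^2$ and $\|x\|_W^2=\sum_{i=1}^m\frac{1}{\gamma_ip_i}\|x_i\|^2$, and $\mathrm{dist}_{\Gamma^{-1}}(x,S)=\inf_{z\in S}\|x-z\|_{\Gamma^{-1}}$. *)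

theory Defs
  imports "HOL-Probability.Probability"
begin

text \<open>
  A family of possibly different Hilbert spaces \<open>H\<^sub>i\<close> is given by subsets \<open>V i\<close> of one inner product
  type. This is no restriction: any family embeds isometrically in, e.g., its own direct sum.
  The ambient type itself need not be complete or separable.
\<close>

definition separable_hilbert :: "'a::real_inner set \<Rightarrow> bool" where
  "separable_hilbert V \<longleftrightarrow> subspace V \<and> Topological_Spaces.complete V \<and> separable_space (top_of_set V)"

text \<open>The inner product of the type \<open>'a ^ 'm\<close> is the sum of the componentwise inner products.\<close>

definition direct_sum :: "('m::finite \<Rightarrow> 'a::real_inner set) \<Rightarrow> ('a ^ 'm) set" where
  "direct_sum V = {x. \<forall>i. x $ i \<in> V i}"

text \<open>Gradient on the Hilbert space \<open>H\<close>, i.e. the Riesz representative in \<open>H\<close> of the Frechet derivative.\<close>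

definition gradient_on :: "'b::real_inner set \<Rightarrow> ('b \<Rightarrow> real) \<Rightarrow> 'b \<Rightarrow> 'b" where
  "gradient_on H f x = (THE g. g \<in> H \<and> (f has_derivative (\<lambda>v. g \<bullet> v)) (at x within H))"

definition proper_on :: "'a set \<Rightarrow> ('a \<Rightarrow> ereal) \<Rightarrow> bool" where
  "proper_on V \<phi> \<longleftrightarrow> (\<forall>x\<in>V. \<phi> x \<noteq> -\<infinity>) \<and> (\<exists>x\<in>V. \<phi> x \<noteq> \<infinity>)"

definition ereal_convex_on :: "'a::real_vector set \<Rightarrow> ('a \<Rightarrow> ereal) \<Rightarrow> bool" where
  "ereal_convex_on V \<phi> \<longleftrightarrow> convex V \<and>
    (\<forall>x\<in>V. \<forall>y\<in>V. \<forall>t. 0 < t \<and> t < 1 \<longrightarrow>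
      \<phi> (t *\<^sub>R x + (1 - t) *\<^sub>R y) \<le> ereal t * \<phi> x + ereal (1 - t) * \<phi> y)"

definition lsc_on :: "'a::topological_space set \<Rightarrow> ('a \<Rightarrow> ereal) \<Rightarrow> bool" where
  "lsc_on V \<phi> \<longleftrightarrow> (\<forall>x\<in>V. \<phi> x \<le> Liminf (at x within V) \<phi>)"

definition argmin_on :: "'a set \<Rightarrow> ('a \<Rightarrow> ereal) \<Rightarrow> 'a set" where
  "argmin_on V \<phi> = {x. is_arg_min \<phi> (\<lambda>z. z \<in> V) x}"

definition prox_on :: "'a::real_inner set \<Rightarrow> ('a \<Rightarrow> ereal) \<Rightarrow> 'a \<Rightarrow> 'a" where
  "prox_on V \<phi> x = arg_min_on (\<lambda>z. \<phi> z + ereal ((norm (x - z))\<^sup>2 / 2)) V"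

text \<open>Elements of \<open>{0,1}\<^sup>m\<close> are functions \<open>'m \<Rightarrow> bool\<close>, with \<open>True\<close> standing for \<open>1\<close>.\<close>

definition mask :: "('m::finite \<Rightarrow> bool) \<Rightarrow> 'a::real_vector ^ 'm \<Rightarrow> 'a ^ 'm" (infixr \<open>\<odot>\<close> 75) where
  "e \<odot> v = (\<chi> i. of_bool (e i) *\<^sub>R (v $ i))"

definition wnorm :: "('m::finite \<Rightarrow> real) \<Rightarrow> 'a::real_normed_vector ^ 'm \<Rightarrow> real" where
  "wnorm w x = sqrt (\<Sum>i\<in>UNIV. w i * (norm (x $ i))\<^sup>2)"

definition wdist :: "('m::finite \<Rightarrow> real) \<Rightarrow> 'a::real_normed_vector ^ 'm \<Rightarrow> ('a ^ 'm) set \<Rightarrow> real" where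
  "wdist w x S = (INF z\<in>S. wnorm w (x - z))"

text \<open>The full forward-backward step \<open>(prox\<^bsub>\<gamma>\<^sub>i h\<^sub>i\<^esub> (x\<^sub>i - \<gamma>\<^sub>i \<nabla>\<^sub>i f(x)))\<^sub>i\<close>.\<close>

definition fb_step ::
  "('m::finite \<Rightarrow> 'a::real_inner set) \<Rightarrow> ('a ^ 'm \<Rightarrow> real) \<Rightarrow> ('m \<Rightarrow> 'a \<Rightarrow> ereal) \<Rightarrow> ('m \<Rightarrow> real)
    \<Rightarrow> 'a ^ 'm \<Rightarrow> 'a ^ 'm" where
  "fb_step V f h \<gamma> x =
    (\<chi> i. prox_on (V i) (\<lambda>z. ereal (\<gamma> i) * h i z)
            (x $ i - \<gamma> i *\<^sub>R (gradient_on (direct_sum V) f x $ i)))"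

end

theory Submission
  imports Defs
begin

text \<open>
  Write \<open>v = T y - y\<close> for the full forward-backward step \<open>T\<close> and \<open>a = (2 - \<delta>) / 2\<close>. The smoothness
  assumption bounds the expected change of \<open>F\<close> under a masked step by \<open>\<Sum>\<^sub>i p\<^sub>i D\<^sub>i\<close>, where the
  variational inequality of the proximal map gives \<open>D\<^sub>i \<le> - a \<parallel>v\<^sub>i\<parallel>\<^sup>2 / \<gamma>\<^sub>i \<le> 0\<close> when tested at \<open>y\<close>, and
  \<open>\<Sum>\<^sub>i D\<^sub>i \<le> - (F y - F\<^sub>*) - a \<parallel>v\<parallel>\<^sup>2 + \<parallel>v\<parallel> dist(y, S\<^sub>*)\<close> in the norm weighted by \<open>1 / \<gamma>\<^sub>i\<close> when tested at
  minimizers. With the error bound \<open>dist(y, S\<^sub>*) \<le> c \<parallel>v\<parallel>\<close>, the convex combination of both estimates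
  with weight \<open>\<theta> = min 1 (a / c)\<close> on the second absorbs \<open>\<parallel>v\<parallel>\<^sup>2\<close> and yields the contraction factor
  \<open>1 - pmin \<theta>\<close>. The first estimate also bounds \<open>E \<parallel>x\<^sup>n\<^sup>+\<^sup>1 - x\<^sup>n\<parallel>\<^sup>2\<close> by a multiple of \<open>E F(x\<^sup>n) - F\<^sub>*\<close>, so the
  expected increments decay like \<open>q\<^sup>n\<^sup>/\<^sup>2\<close> and are summable. Every \<open>x\<^sup>n\<close> takes finitely many values,
  which makes all measurability questions elementary although the ambient type is not separable.
\<close>

section \<open>Proximal maps and gradients on complete subspaces\<close>

text \<open>A closed epigraph keeps \<open>\<phi>\<close> above \<open>\<phi> z0 - 1\<close> on a
  ball around \<open>z0\<close>. Convexity carries this along segments leaving the ball to a lower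
  bound that falls at most linearly in the distance, and the quadratic term dominates that.\<close>

lemma prox_objective_bounded_below:
  fixes \<phi> :: "'a::real_inner \<Rightarrow> real"
  assumes cvx: "convex_on D \<phi>" and clo: "closed (epigraph D \<phi>)" and z0: "z0 \<in> D"
  shows "\<exists>m. \<forall>z\<in>D. m \<le> \<phi> z + (norm (x - z))\<^sup>2 / 2"
proof -
  have "\<exists>r>0. \<forall>z\<in>D. norm (z - z0) < r \<longrightarrow> \<phi> z0 - 1 < \<phi> z"
  proof (rule ccontr)
    assume "\<not> ?thesis"
    then have neg: "\<exists>z\<in>D. norm (z - z0) < r \<and> \<phi> z \<le> \<phi> z0 - 1" if "r > 0" for r
      using that by (force simp: not_less)
    have "\<forall>n. \<exists>z\<in>D. norm (z - z0) < inverse (real (Suc n)) \<and> \<phi> z \<le> \<phi> z0 - 1"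
      by (intro allI neg) simp
    then obtain s where s: "\<And>n. s n \<in> D" "\<And>n. norm (s n - z0) < inverse (real (Suc n))"
      "\<And>n. \<phi> (s n) \<le> \<phi> z0 - 1" by metis
    have "(\<lambda>n. s n - z0) \<longlonglongrightarrow> 0"
      by (rule Lim_null_comparison[OF _ LIMSEQ_inverse_real_of_nat]) (intro always_eventually allI less_imp_le s(2))
    then have "s \<longlonglongrightarrow> z0" by (simp add: LIM_zero_iff)
    then have lim: "(\<lambda>n. (s n, \<phi> z0 - 1)) \<longlonglongrightarrow> (z0, \<phi> z0 - 1)" by (intro tendsto_intros)
    have "(s n, \<phi> z0 - 1) \<in> epigraph D \<phi>" for n using s by (simp add: epigraph_def)
    then have "(z0, \<phi> z0 - 1) \<in> epigraph D \<phi>"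
      by (rule closed_sequentially[OF clo _ lim])
    then show False by (simp add: epigraph_def)
  qed
  then obtain r where r: "r > 0" "\<And>z. z \<in> D \<Longrightarrow> norm (z - z0) < r \<Longrightarrow> \<phi> z0 - 1 < \<phi> z" by blast
  \<comment> \<open>The slope comes from cutting the segment from \<open>z0\<close> to
    \<open>z\<close> at distance \<open>r / 2\<close>: then \<open>t = r / (2 * N)\<close> and
    \<open>1 / t = \<beta> * N\<close>.\<close>
  define \<beta> where "\<beta> = 2 / r"
  have \<beta>: "\<beta> > 0" using r by (simp add: \<beta>_def)
  have lin: "\<phi> z0 - 1 - \<beta> * norm (z - z0) \<le> \<phi> z" if z: "z \<in> D" for z
  proof (cases "norm (z - z0) < r")
    case True
    then show ?thesis using r(2)[OF z] \<beta> by (smt (verit) mult_nonneg_nonneg norm_ge_zero)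
  next
    case False
    define N where "N = norm (z - z0)"
    define t where "t = r / (2 * N)"
    have N: "N \<ge> r" "N > 0" using False r by (auto simp: N_def)
    have t: "0 < t" "t < 1" using N r by (auto simp: t_def field_simps)
    let ?y = "(1 - t) *\<^sub>R z0 + t *\<^sub>R z"
    have "?y \<in> D" using convexD_alt[of D z0 z t] cvx z z0 t by (auto simp: convex_on_def)
    moreover have "norm (?y - z0) < r"
    proof -
      have "?y - z0 = t *\<^sub>R (z - z0)" by (simp add: algebra_simps)
      then have "norm (?y - z0) = t * N" using t by (simp add: N_def)
      also have "\<dots> = r / 2" using N by (simp add: t_def)
      finally show ?thesis using r by simp
    qed
    ultimately have "\<phi> z0 - 1 < \<phi> ?y" using r by blast
    also have "\<phi> ?y \<le> (1 - t) * \<phi> z0 + t * \<phi> z"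
      using convex_onD[OF cvx, of t z0 z] t z z0 by simp
    finally have "t * (\<phi> z0 - \<phi> z) < 1" by (simp add: algebra_simps)
    then have "\<phi> z0 - \<phi> z < 1 / t" using t by (simp add: field_simps)
    also have "1 / t = \<beta> * N" using N r by (simp add: t_def \<beta>_def)
    finally show ?thesis by (simp add: N_def)
  qed
  show ?thesis
  proof (intro exI ballI)
    fix z assume z: "z \<in> D"
    have "\<beta> * norm (z - z0) \<le> \<beta> * (norm (x - z) + norm (x - z0))"
      using \<beta> norm_triangle_ineq4[of "x - z0" "x - z"] by (intro mult_left_mono) auto
    moreover have "0 \<le> (norm (x - z) - \<beta>)\<^sup>2" by simp
    then have "\<beta> * norm (x - z) \<le> (norm (x - z))\<^sup>2 / 2 + \<beta>\<^sup>2 / 2" by (simp add: power2_diff mult.commute)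
    ultimately show "\<phi> z0 - 1 - \<beta> * norm (x - z0) - \<beta>\<^sup>2 / 2 \<le> \<phi> z + (norm (x - z))\<^sup>2 / 2"
      using lin[OF z] by (simp add: algebra_simps)
  qed
qed

text \<open>The parallelogram law for \<open>x - a\<close> and \<open>x - b\<close>. It carries the
  strong convexity of the quadratic term, which makes minimizing sequences Cauchy.\<close>

lemma norm_midpoint_identity:
  fixes x a b :: "'a::real_inner"
  shows "(norm (x - ((1/2) *\<^sub>R a + (1/2) *\<^sub>R b)))\<^sup>2
    = (norm (x - a))\<^sup>2 / 2 + (norm (x - b))\<^sup>2 / 2 - (norm (a - b))\<^sup>2 / 4"
  unfolding power2_norm_eq_inner
  by (simp add: algebra_simps inner_commute add_divide_distrib diff_divide_distrib)

text \<open>Direct method: midpoints of a minimizing sequence cannot undercut the infimum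
  \<open>m\<close>, which bounds the mutual distances and makes the sequence Cauchy. Completeness of
  \<open>V\<close> gives a limit, and closedness of the epigraph puts it in \<open>D\<close> with
  objective at most \<open>m\<close>.\<close>

lemma prox_minimizer_exists:
  fixes \<phi> :: "'a::real_inner \<Rightarrow> real"
  assumes V: "Topological_Spaces.complete V" and DV: "D \<subseteq> V" and ne: "D \<noteq> {}"
    and cvx: "convex_on D \<phi>" and clo: "closed (epigraph D \<phi>)"
  obtains z where "z \<in> D"
    "\<And>y. y \<in> D \<Longrightarrow> \<phi> z + (norm (x - z))\<^sup>2 / 2 \<le> \<phi> y + (norm (x - y))\<^sup>2 / 2"
proof -
  define J where "J z = \<phi> z + (norm (x - z))\<^sup>2 / 2" for z
  define m where "m = (INF z\<in>D. J z)"
  have bdd: "bdd_below (J ` D)"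
    using prox_objective_bounded_below[OF cvx clo] ne unfolding J_def bdd_below_def by blast
  have m: "m \<le> J z" if "z \<in> D" for z unfolding m_def using bdd that by (rule cINF_lower)
  have "\<exists>z\<in>D. J z < m + inverse (real (Suc n))" for n
    using cINF_less_iff[OF ne bdd, of "m + inverse (real (Suc n))"] unfolding m_def by auto
  then obtain s where s: "\<And>n. s n \<in> D" "\<And>n. J (s n) < m + inverse (real (Suc n))" by metis
  have dist: "(norm (s n - s k))\<^sup>2 \<le> 4 * (inverse (real (Suc n)) + inverse (real (Suc k)))" for n k
  proof -
    define w where "w = (1/2) *\<^sub>R s n + (1/2) *\<^sub>R s k"
    have "w \<in> D" using convexD[of D "s n" "s k" "1/2" "1/2"] cvx s by (auto simp: convex_on_def w_def)
    then have "m \<le> \<phi> w + (norm (x - w))\<^sup>2 / 2" using m by (simp add: J_def)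
    moreover have "\<phi> w \<le> \<phi> (s n) / 2 + \<phi> (s k) / 2"
      using convex_onD[OF cvx, of "1/2" "s n" "s k"] s by (simp add: w_def)
    moreover note norm_midpoint_identity[of x "s n" "s k", folded w_def]
      s(2)[of n, unfolded J_def] s(2)[of k, unfolded J_def]
    ultimately show ?thesis by argo
  qed
  have "Cauchy s"
  proof (rule metric_CauchyI)
    fix e :: real assume e: "0 < e"
    then obtain N where N: "inverse (real (Suc N)) < e\<^sup>2 / 8" using reals_Archimedean[of "e\<^sup>2/8"] by auto
    have "dist (s n) (s k) < e" if "n \<ge> N" "k \<ge> N" for n k
    proof -
      have "inverse (real (Suc n)) \<le> inverse (real (Suc N))" "inverse (real (Suc k)) \<le> inverse (real (Suc N))"
        using that by (auto intro!: le_imp_inverse_le)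
      then have "(norm (s n - s k))\<^sup>2 < e\<^sup>2" using dist[of n k] N by argo
      then show ?thesis using e by (auto simp: dist_norm intro: power2_less_imp_less)
    qed
    then show "\<exists>N. \<forall>n\<ge>N. \<forall>k\<ge>N. dist (s n) (s k) < e" by blast
  qed
  then obtain z where z: "s \<longlonglongrightarrow> z" using V DV s(1) unfolding complete_def by blast
  \<comment> \<open>Convergence of \<open>\<phi> (s n)\<close> is not known, so the heights
    \<open>r n\<close> replace it: they lie above \<open>\<phi> (s n)\<close> and converge by
    construction.\<close>
  define r where "r n = m + inverse (real (Suc n)) - (norm (x - s n))\<^sup>2 / 2" for n
  have "r \<longlonglongrightarrow> m + 0 - (norm (x - z))\<^sup>2 / 2"
    unfolding r_def by (intro tendsto_intros z LIMSEQ_inverse_real_of_nat) auto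
  then have lim: "(\<lambda>n. (s n, r n)) \<longlonglongrightarrow> (z, m + 0 - (norm (x - z))\<^sup>2 / 2)" using z by (intro tendsto_intros)
  have "(s n, r n) \<in> epigraph D \<phi>" for n
    using s[of n] by (simp add: epigraph_def r_def J_def)
  then have "(z, m + 0 - (norm (x - z))\<^sup>2 / 2) \<in> epigraph D \<phi>"
    by (rule closed_sequentially[OF clo _ lim])
  then have "z \<in> D" "J z \<le> m" by (auto simp: epigraph_def J_def)
  then show thesis using m that unfolding J_def by (meson order_trans)
qed

text \<open>Moving from \<open>z\<close> a fraction \<open>t\<close> towards \<open>y\<close>
  changes the quadratic term by a first-order part and an error of order \<open>t\<^sup>2\<close>.
  Dividing by \<open>t\<close> and letting \<open>t\<close> tend to 0 shows that
  \<open>x - z\<close> is a subgradient of \<open>\<phi>\<close> at \<open>z\<close>.\<close>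

lemma prox_variational_inequality:
  fixes \<phi> :: "'a::real_inner \<Rightarrow> real"
  assumes cvx: "convex_on D \<phi>" and z: "z \<in> D" and y: "y \<in> D"
    and min: "\<And>y. y \<in> D \<Longrightarrow> \<phi> z + (norm (x - z))\<^sup>2 / 2 \<le> \<phi> y + (norm (x - y))\<^sup>2 / 2"
  shows "\<phi> z + (x - z) \<bullet> (y - z) \<le> \<phi> y"
proof -
  have "\<phi> z + (x - z) \<bullet> (y - z) - \<phi> y \<le> t * ((norm (y - z))\<^sup>2 / 2)" if t: "0 < t" "t < 1" for t :: real
  proof -
    let ?w = "(1 - t) *\<^sub>R z + t *\<^sub>R y"
    have "?w \<in> D" using convexD_alt[of D z y t] cvx z y t by (auto simp: convex_on_def)
    then have "\<phi> z + (norm (x - z))\<^sup>2 / 2 \<le> \<phi> ?w + (norm (x - ?w))\<^sup>2 / 2" by (rule min)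
    moreover have "\<phi> ?w \<le> (1 - t) * \<phi> z + t * \<phi> y"
      using convex_onD[OF cvx, of t z y] t z y by simp
    moreover have "(norm (x - ?w))\<^sup>2 = (norm (x - z))\<^sup>2 - 2 * t * ((x - z) \<bullet> (y - z)) + t * (t * (norm (y - z))\<^sup>2)"
      unfolding power2_norm_eq_inner
      by (simp add: algebra_simps inner_commute)
    ultimately have "t * (\<phi> z + (x - z) \<bullet> (y - z) - \<phi> y) \<le> t * (t * ((norm (y - z))\<^sup>2 / 2))"
      by (simp add: algebra_simps)
    then show ?thesis using t by simp
  qed
  then have "\<forall>\<^sub>F t in at_right 0. \<phi> z + (x - z) \<bullet> (y - z) - \<phi> y \<le> t * ((norm (y - z))\<^sup>2 / 2)"
    by (auto simp: eventually_at_right[of 0 1] intro: exI[of _ 1])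
  moreover have "((\<lambda>t. t * ((norm (y - z))\<^sup>2 / 2)) \<longlongrightarrow> 0 * ((norm (y - z))\<^sup>2 / 2)) (at_right 0)"
    by (intro tendsto_intros)
  ultimately have "\<phi> z + (x - z) \<bullet> (y - z) - \<phi> y \<le> 0 * ((norm (y - z))\<^sup>2 / 2)"
    by (intro tendsto_lowerbound) auto
  then show ?thesis by simp
qed

text \<open>The representer of \<open>L\<close> is the proximal point of the linear function \<open>- L\<close> at the origin.\<close>

lemma riesz_representation:
  fixes L :: "'a::real_inner \<Rightarrow> real"
  assumes V: "Topological_Spaces.complete V" "subspace V" and L: "bounded_linear L"
  obtains g where "g \<in> V" "\<And>v. v \<in> V \<Longrightarrow> L v = g \<bullet> v"
proof -
  interpret L: bounded_linear L by (rule L)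
  have cvx: "convex_on V (\<lambda>v. - L v)"
    by (rule convex_onI) (auto simp: L.add L.scaleR subspace_imp_convex V)
  have "closed ((V \<times> UNIV) \<inter> {p. - L (fst p) \<le> snd p})"
    by (intro closed_Int closed_Times complete_imp_closed V closed_UNIV closed_Collect_le
        continuous_intros L.continuous_on)
  also have "(V \<times> UNIV) \<inter> {p. - L (fst p) \<le> snd p} = epigraph V (\<lambda>v. - L v)"
    by (auto simp: epigraph_def)
  finally have clo: "closed (epigraph V (\<lambda>v. - L v))" .
  have ne: "V \<noteq> {}" using V(2) subspace_0 by blast
  obtain g where g: "g \<in> V"
    "\<And>y. y \<in> V \<Longrightarrow> - L g + (norm (0 - g))\<^sup>2 / 2 \<le> - L y + (norm (0 - y))\<^sup>2 / 2"
    using prox_minimizer_exists[OF V(1) order_refl ne cvx clo, of 0] by blast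
  have var: "- L g + (0 - g) \<bullet> (y - g) \<le> - L y" if "y \<in> V" for y
    using prox_variational_inequality[OF cvx g(1) that g(2)] .
  have le: "L v \<le> g \<bullet> v" if "v \<in> V" for v
    using var[of "g + v"] subspace_add[OF V(2) g(1) that] by (simp add: L.add)
  have "L v = g \<bullet> v" if "v \<in> V" for v
    using le[OF that] le[of "- v"] subspace_neg[OF V(2) that] by (simp add: L.neg)
  then show thesis using that g(1) by blast
qed

section \<open>Derivatives and gradients within a subspace\<close>

lemma has_derivative_within_subspace_along:
  fixes f :: "'b::real_inner \<Rightarrow> real"
  assumes H: "subspace H" "y \<in> H" "v \<in> H" and D: "(f has_derivative D) (at y within H)"
  shows "((\<lambda>t. f (y + t *\<^sub>R v)) has_real_derivative D v) (at 0)"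
proof -
  have "((\<lambda>t. f (y + t *\<^sub>R v)) has_derivative (\<lambda>t. D (t *\<^sub>R v))) (at 0 within UNIV)"
  proof (rule has_derivative_in_compose[of "\<lambda>t. y + t *\<^sub>R v" "\<lambda>t. t *\<^sub>R v" 0 UNIV f D])
    show "((\<lambda>t. y + t *\<^sub>R v) has_derivative (\<lambda>t. t *\<^sub>R v)) (at 0 within UNIV)"
      by (auto intro!: derivative_eq_intros)
    \<comment> \<open>The whole line stays in \<open>H\<close>, so a derivative within
      \<open>H\<close> yields an ordinary derivative in \<open>t\<close>, even if \<open>H\<close>
      has empty interior.\<close>
    have "range (\<lambda>t. y + t *\<^sub>R v) \<subseteq> H" using H by (auto intro!: subspace_add subspace_scale)
    then show "(f has_derivative D) (at (y + 0 *\<^sub>R v) within range (\<lambda>t. y + t *\<^sub>R v))"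
      using has_derivative_subset[OF D] by simp
  qed
  moreover have "D (t *\<^sub>R v) = D v * t" for t
    using has_derivative_bounded_linear[OF D] by (simp add: linear_simps)
  ultimately show ?thesis by (simp add: has_field_derivative_def mult_commute_abs)
qed

text \<open>Shows that the definite description in \<open>gradient_on\<close> is well defined: the
  Riesz representer gives existence, and directional derivatives along the difference of two
  candidates give uniqueness.\<close>

lemma gradient_on_props:
  fixes f :: "'b::real_inner \<Rightarrow> real"
  assumes H: "Topological_Spaces.complete H" "subspace H" and y: "y \<in> H" and f: "f differentiable (at y within H)"
  shows "gradient_on H f y \<in> H"
    and "(f has_derivative (\<lambda>v. gradient_on H f y \<bullet> v)) (at y within H)"
proof -
  obtain D where D: "(f has_derivative D) (at y within H)" using f differentiable_def by blast
  obtain g where g: "g \<in> H" "\<And>v. v \<in> H \<Longrightarrow> D v = g \<bullet> v"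
    using riesz_representation[OF H has_derivative_bounded_linear[OF D]] by blast
  have "(f has_derivative (\<lambda>v. g \<bullet> v)) (at y within H)"
  proof -
    have "((\<lambda>z. ((f z - f y) - D (z - y)) /\<^sub>R norm (z - y)) \<longlongrightarrow> 0) (at y within H)"
      using D by (simp add: has_derivative_at_within)
    \<comment> \<open>\<open>D\<close> and the inner product with \<open>g\<close> may differ off
      \<open>H\<close>, but the quotient within \<open>H\<close> only sees \<open>z - y\<close>,
      which lies in \<open>H\<close>.\<close>
    moreover have "\<forall>\<^sub>F z in at y within H. ((f z - f y) - D (z - y)) /\<^sub>R norm (z - y) = ((f z - f y) - g \<bullet> (z - y)) /\<^sub>R norm (z - y)"
      using g(2) subspace_diff[OF H(2)] y by (auto simp: eventually_at_filter)
    ultimately have "((\<lambda>z. ((f z - f y) - g \<bullet> (z - y)) /\<^sub>R norm (z - y)) \<longlongrightarrow> 0) (at y within H)"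
      by (rule Lim_transform_eventually)
    then show ?thesis by (simp add: has_derivative_at_within bounded_linear_inner_right)
  qed
  moreover have "g' = g" if g': "g' \<in> H" "(f has_derivative (\<lambda>v. g' \<bullet> v)) (at y within H)" for g'
  proof -
    have v: "g - g' \<in> H" using subspace_diff[OF H(2)] g g' by blast
    have "g' \<bullet> (g - g') = D (g - g')"
      using has_derivative_within_subspace_along[OF H(2) y v g'(2)]
        has_derivative_within_subspace_along[OF H(2) y v D] DERIV_unique by blast
    then have "(g - g') \<bullet> (g - g') = 0" using g(2)[OF v] by (simp add: inner_diff_left)
    then show ?thesis by simp
  qed
  ultimately have "\<exists>!g. g \<in> H \<and> (f has_derivative (\<lambda>v. g \<bullet> v)) (at y within H)" using g(1) by blast
  from theI'[OF this] show "gradient_on H f y \<in> H"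
    "(f has_derivative (\<lambda>v. gradient_on H f y \<bullet> v)) (at y within H)"
    unfolding gradient_on_def by auto
qed

text \<open>The line through \<open>y\<close> and \<open>z\<close> stays in \<open>H\<close>, so
  \<open>f\<close> restricts to a convex function on all reals and the one-dimensional tangent
  inequality applies.\<close>

lemma convex_gradient_inequality:
  fixes f :: "'b::real_inner \<Rightarrow> real"
  assumes H: "subspace H" "y \<in> H" "z \<in> H" and cvx: "convex_on H f"
    and D: "(f has_derivative (\<lambda>v. g \<bullet> v)) (at y within H)"
  shows "f y + g \<bullet> (z - y) \<le> f z"
proof -
  let ?\<psi> = "\<lambda>t::real. f (y + t *\<^sub>R (z - y))"
  have v: "z - y \<in> H" using subspace_diff H by blast
  have mem: "y + t *\<^sub>R (z - y) \<in> H" for t using H v by (intro subspace_add subspace_scale)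
  have "convex_on UNIV ?\<psi>"
  proof (rule convex_onI)
    fix t a b :: real assume t: "0 < t" "t < 1"
    have "y + ((1 - t) *\<^sub>R a + t *\<^sub>R b) *\<^sub>R (z - y)
      = (1 - t) *\<^sub>R (y + a *\<^sub>R (z - y)) + t *\<^sub>R (y + b *\<^sub>R (z - y))" by (simp add: algebra_simps)
    then show "?\<psi> ((1 - t) *\<^sub>R a + t *\<^sub>R b) \<le> (1 - t) * ?\<psi> a + t * ?\<psi> b"
      using convex_onD[OF cvx, of t "y + a *\<^sub>R (z - y)" "y + b *\<^sub>R (z - y)"] t mem by simp
  qed auto
  then have "?\<psi> 1 - ?\<psi> 0 \<ge> (g \<bullet> (z - y)) * (1 - 0)"
    using has_derivative_within_subspace_along[OF H(1,2) v D]
    by (intro convex_on_imp_above_tangent[where A = UNIV]) auto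
  then show ?thesis by simp
qed

section \<open>Lower semicontinuous convex functions with extended-real values\<close>

lemma lsc_on_eventually_less:
  assumes lsc: "lsc_on V \<phi>" and s: "\<And>n. s n \<in> V" "s \<longlonglongrightarrow> z" "z \<in> V" and C: "C < \<phi> z"
  shows "\<forall>\<^sub>F n in sequentially. C < \<phi> (s n)"
proof -
  have "C < Liminf (at z within V) \<phi>" using lsc s(3) C unfolding lsc_on_def by (meson less_le_trans)
  then have "\<forall>\<^sub>F y in at z within V. C < \<phi> y" by (rule less_LiminfD)
  \<comment> \<open>The filter \<open>at z within V\<close> leaves out \<open>z\<close> itself;
    terms with \<open>s n = z\<close> are covered by \<open>C < \<phi> z\<close>.\<close>
  then have "\<forall>\<^sub>F y in nhds z. y \<noteq> z \<longrightarrow> y \<in> V \<longrightarrow> C < \<phi> y" by (simp add: eventually_at_filter)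
  then have "\<forall>\<^sub>F n in sequentially. s n \<noteq> z \<longrightarrow> s n \<in> V \<longrightarrow> C < \<phi> (s n)"
    using s(2) by (rule eventually_compose_filterlim)
  then show ?thesis by eventually_elim (use s(1) C in metis)
qed

text \<open>The effective domain may fail to be closed, but heights converging to a real
  \<open>l\<close> force \<open>\<phi> z \<le> ereal l\<close>, which keeps the limit in it. This
  puts the hypothesis on \<open>h\<close> into the form used by the existence proof for proximal
  points.\<close>

lemma lsc_on_closed_epigraph:
  fixes \<phi> :: "'a::real_inner \<Rightarrow> ereal"
  assumes V: "Topological_Spaces.complete V" and lsc: "lsc_on V \<phi>" and proper: "proper_on V \<phi>"
  shows "closed (epigraph {z \<in> V. \<phi> z \<noteq> \<infinity>} (\<lambda>z. real_of_ereal (\<phi> z)))"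
proof (unfold closed_sequential_limits, intro allI impI, elim conjE)
  fix s :: "nat \<Rightarrow> 'a \<times> real" and p
  assume s: "\<forall>n. s n \<in> epigraph {z \<in> V. \<phi> z \<noteq> \<infinity>} (\<lambda>z. real_of_ereal (\<phi> z))" and lim: "s \<longlonglongrightarrow> p"
  obtain z l where p: "p = (z, l)" by (cases p)
  have z: "(\<lambda>n. fst (s n)) \<longlonglongrightarrow> z" and l: "(\<lambda>n. snd (s n)) \<longlonglongrightarrow> l"
    using tendsto_fst[OF lim] tendsto_snd[OF lim] by (auto simp: p)
  have sV: "fst (s n) \<in> V" for n using s by (auto simp: epigraph_def)
  have le: "\<phi> (fst (s n)) \<le> ereal (snd (s n))" for n
    using s[rule_format, of n] proper
    by (cases "\<phi> (fst (s n))") (auto simp: epigraph_def proper_on_def)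
  have zV: "z \<in> V" using closed_sequentially[OF complete_imp_closed[OF V] sV z] .
  have "\<phi> z \<le> ereal l"
  proof (rule ccontr)
    assume "\<not> ?thesis"
    then have "ereal l < \<phi> z" by simp
    then obtain C where C: "ereal l < ereal C" "ereal C < \<phi> z" using ereal_dense2 by blast
    have "\<forall>\<^sub>F n in sequentially. ereal C < \<phi> (fst (s n))"
      by (rule lsc_on_eventually_less[OF lsc sV z zV C(2)])
    moreover have "\<forall>\<^sub>F n in sequentially. snd (s n) < C" using l C(1) by (intro order_tendstoD) auto
    ultimately have "\<forall>\<^sub>F n in sequentially. False"
      by eventually_elim (metis le less_ereal.simps(1) not_less order_trans less_le_not_le)
    then show False by simp
  qed
  then show "p \<in> epigraph {z \<in> V. \<phi> z \<noteq> \<infinity>} (\<lambda>z. real_of_ereal (\<phi> z))"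
    using zV proper by (cases "\<phi> z") (auto simp: epigraph_def p proper_on_def)
qed

lemma ereal_convex_on_real:
  assumes cvx: "ereal_convex_on V \<phi>" and proper: "proper_on V \<phi>"
  shows "convex_on {z \<in> V. \<phi> z \<noteq> \<infinity>} (\<lambda>z. real_of_ereal (\<phi> z))"
proof -
  have V: "convex V" using cvx by (simp add: ereal_convex_on_def)
  have key: "(1 - t) *\<^sub>R x + t *\<^sub>R y \<in> V \<and> \<phi> ((1 - t) *\<^sub>R x + t *\<^sub>R y) \<noteq> \<infinity> \<and>
     real_of_ereal (\<phi> ((1 - t) *\<^sub>R x + t *\<^sub>R y)) \<le> (1 - t) * real_of_ereal (\<phi> x) + t * real_of_ereal (\<phi> y)"
    if t: "0 < t" "t < 1" and x: "x \<in> V" "\<phi> x \<noteq> \<infinity>" and y: "y \<in> V" "\<phi> y \<noteq> \<infinity>" for t x y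
  proof -
    let ?w = "(1 - t) *\<^sub>R x + t *\<^sub>R y"
    have w: "?w \<in> V" using convexD_alt[OF V x(1) y(1)] t by simp
    obtain a b where ab: "\<phi> x = ereal a" "\<phi> y = ereal b"
      using x y proper unfolding proper_on_def by (metis ereal_cases)
    \<comment> \<open>\<open>ereal_convex_on\<close> puts the weight \<open>t\<close> on the first
      point and \<open>convex_on\<close> puts \<open>1 - t\<close> there, hence the instance with
      \<open>1 - t\<close>.\<close>
    have "0 < 1 - t \<and> 1 - t < 1" using t by simp
    then have "\<phi> ((1 - t) *\<^sub>R x + (1 - (1 - t)) *\<^sub>R y) \<le> ereal (1 - t) * \<phi> x + ereal (1 - (1 - t)) * \<phi> y"
      using cvx x(1) y(1) unfolding ereal_convex_on_def by blast
    then have "\<phi> ?w \<le> ereal ((1 - t) * a + t * b)" by (simp add: ab)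
    moreover have "\<phi> ?w \<noteq> -\<infinity>" using w proper by (simp add: proper_on_def)
    ultimately show ?thesis using w ab by (cases "\<phi> ?w") auto
  qed
  show ?thesis
  proof (rule convex_onI)
    show "convex {z \<in> V. \<phi> z \<noteq> \<infinity>}"
      unfolding convex_alt
    proof (intro ballI allI impI)
      fix x y and u :: real
      assume xy: "x \<in> {z \<in> V. \<phi> z \<noteq> \<infinity>}" "y \<in> {z \<in> V. \<phi> z \<noteq> \<infinity>}" and u: "0 \<le> u \<and> u \<le> 1"
      consider "u = 0" | "u = 1" | "0 < u" "u < 1" using u by linarith
      then show "(1 - u) *\<^sub>R x + u *\<^sub>R y \<in> {z \<in> V. \<phi> z \<noteq> \<infinity>}"
        by cases (use xy key[of u x y] in auto)
    qed
  qed (use key in auto)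
qed

text \<open>The objective is infinite outside the effective domain, so a real minimizer over
  \<open>D\<close> minimizes over \<open>V\<close>. \<open>prox_on\<close> then selects some
  minimizer, and every minimizer obeys the variational inequality; dividing by
  \<open>\<gamma>\<close> makes \<open>(x - z) / \<gamma>\<close> a subgradient of
  \<open>\<phi>\<close>.\<close>

lemma prox_on_props:
  fixes \<phi> :: "'a::real_inner \<Rightarrow> ereal" and x :: 'a
  assumes V: "Topological_Spaces.complete V" and proper: "proper_on V \<phi>" and cvx: "ereal_convex_on V \<phi>"
    and lsc: "lsc_on V \<phi>" and \<gamma>: "0 < \<gamma>"
  defines "z \<equiv> prox_on V (\<lambda>z. ereal \<gamma> * \<phi> z) x"
  shows "z \<in> V" and "\<phi> z \<noteq> \<infinity>"
    and "\<And>y. y \<in> V \<Longrightarrow> \<phi> y \<noteq> \<infinity> \<Longrightarrow>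
           real_of_ereal (\<phi> z) + (1 / \<gamma>) * ((x - z) \<bullet> (y - z)) \<le> real_of_ereal (\<phi> y)"
proof -
  define D where "D = {z \<in> V. \<phi> z \<noteq> \<infinity>}"
  define \<psi> where "\<psi> z = \<gamma> * real_of_ereal (\<phi> z)" for z
  define J where "J z = ereal \<gamma> * \<phi> z + ereal ((norm (x - z))\<^sup>2 / 2)" for z
  have J: "J w = ereal (\<psi> w + (norm (x - w))\<^sup>2 / 2)" if "w \<in> D" for w
    using that proper by (cases "\<phi> w") (auto simp: D_def J_def \<psi>_def proper_on_def)
  have Jinf: "J w = \<infinity>" if "w \<in> V" "w \<notin> D" for w
    using that \<gamma> by (auto simp: D_def J_def)
  have ne: "D \<noteq> {}" using proper by (auto simp: D_def proper_on_def)
  have cD: "convex_on D \<psi>" unfolding D_def \<psi>_def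
    using \<gamma> by (intro convex_on_cmul ereal_convex_on_real cvx proper) auto
  \<comment> \<open>Scaling the function by \<open>\<gamma>\<close> only rescales heights, so
    closedness transfers by a continuous preimage.\<close>
  have "epigraph D \<psi> = (\<lambda>p. (fst p, snd p / \<gamma>)) -` epigraph D (\<lambda>z. real_of_ereal (\<phi> z))"
    using \<gamma> by (auto simp: epigraph_def \<psi>_def field_simps)
  moreover have "closed ((\<lambda>p. (fst p, snd p / \<gamma>)) -` epigraph D (\<lambda>z. real_of_ereal (\<phi> z)))"
    unfolding D_def using \<gamma>
    by (intro continuous_closed_vimage lsc_on_closed_epigraph V lsc proper)
       (auto intro!: continuous_intros)
  ultimately have clo: "closed (epigraph D \<psi>)" by simp
  have DV: "D \<subseteq> V" by (auto simp: D_def)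
  obtain w where w: "w \<in> D"
    "\<And>y. y \<in> D \<Longrightarrow> \<psi> w + (norm (x - w))\<^sup>2 / 2 \<le> \<psi> y + (norm (x - y))\<^sup>2 / 2"
    using prox_minimizer_exists[OF V DV ne cD clo] by blast
  have "is_arg_min J (\<lambda>z. z \<in> V) w"
    unfolding is_arg_min_def
  proof (intro conjI notI)
    show "w \<in> V" using w(1) DV by blast
    assume "\<exists>y. y \<in> V \<and> J y < J w"
    then obtain y where y: "y \<in> V" "J y < J w" by blast
    show False
    proof (cases "y \<in> D")
      case True then show False using y w J by fastforce
    next
      case False then show False using y Jinf by simp
    qed
  qed
  then have z: "is_arg_min J (\<lambda>z. z \<in> V) z"
    unfolding z_def prox_on_def arg_min_on_def arg_min_def J_def by (rule someI)
  have Jz: "J z \<le> J y" if "y \<in> V" for y using z that by (auto simp: is_arg_min_def not_less)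
  have zV: "z \<in> V" using z by (simp add: is_arg_min_def)
  have zD: "z \<in> D"
  proof (rule ccontr)
    assume "z \<notin> D"
    then have "J w = \<infinity>" using Jinf[OF zV] Jz[of w] w(1) DV by auto
    then show False using J[OF w(1)] by simp
  qed
  then show "z \<in> V" "\<phi> z \<noteq> \<infinity>" by (auto simp: D_def)
  fix y assume y: "y \<in> V" "\<phi> y \<noteq> \<infinity>"
  have min: "\<psi> z + (norm (x - z))\<^sup>2 / 2 \<le> \<psi> u + (norm (x - u))\<^sup>2 / 2" if "u \<in> D" for u
    using Jz[of u] J[OF that] J[OF zD] that DV by auto
  have "\<psi> z + (x - z) \<bullet> (y - z) \<le> \<psi> y"
    using y by (intro prox_variational_inequality[OF cD zD _ min]) (auto simp: D_def)
  then show "real_of_ereal (\<phi> z) + (1 / \<gamma>) * ((x - z) \<bullet> (y - z)) \<le> real_of_ereal (\<phi> y)"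
    using \<gamma> by (simp add: \<psi>_def field_simps)
qed

section \<open>The expected decrease of one step\<close>

lemma wnorm_nonneg: "(\<And>i. 0 \<le> w i) \<Longrightarrow> 0 \<le> wnorm w v"
  by (simp add: wnorm_def sum_nonneg)

lemma wnorm_power2: "(\<And>i. 0 \<le> w i) \<Longrightarrow> (wnorm w v)\<^sup>2 = (\<Sum>i\<in>UNIV. w i * (norm (v $ i))\<^sup>2)"
  by (simp add: wnorm_def sum_nonneg)

text \<open>Cauchy-Schwarz twice: in each block, and then for the block norms scaled by
  \<open>sqrt (w i)\<close>.\<close>

lemma weighted_inner_le_wnorm:
  fixes u v :: "'a::real_inner ^ 'm"
  assumes w: "\<And>i. 0 \<le> w i"
  shows "(\<Sum>i\<in>UNIV. w i * ((u $ i) \<bullet> (v $ i))) \<le> wnorm w u * wnorm w v"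
proof -
  have eq: "wnorm w y = L2_set (\<lambda>i. sqrt (w i) * norm (y $ i)) UNIV" for y :: "'a ^ 'm"
    using w by (simp add: wnorm_def L2_set_def power_mult_distrib)
  have "(\<Sum>i\<in>UNIV. w i * ((u $ i) \<bullet> (v $ i))) \<le> (\<Sum>i\<in>UNIV. \<bar>sqrt (w i) * norm (u $ i)\<bar> * \<bar>sqrt (w i) * norm (v $ i)\<bar>)"
  proof (rule sum_mono)
    fix i
    have "w i * ((u $ i) \<bullet> (v $ i)) \<le> (sqrt (w i) * sqrt (w i)) * (norm (u $ i) * norm (v $ i))"
      using w by (auto intro: mult_left_mono norm_cauchy_schwarz)
    also have "\<dots> = \<bar>sqrt (w i) * norm (u $ i)\<bar> * \<bar>sqrt (w i) * norm (v $ i)\<bar>"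
      using w[of i] by (simp add: abs_mult)
    finally show "w i * ((u $ i) \<bullet> (v $ i)) \<le> \<bar>sqrt (w i) * norm (u $ i)\<bar> * \<bar>sqrt (w i) * norm (v $ i)\<bar>" .
  qed
  also have "\<dots> \<le> wnorm w u * wnorm w v" unfolding eq by (rule L2_set_mult_ineq)
  finally show ?thesis .
qed

text \<open>Allows convergence to be proved in the ambient distance and transferred to the weighted
  norm at the end.\<close>

lemma wnorm_le_norm:
  assumes "\<And>i. 0 \<le> w i"
  shows "wnorm w v \<le> sqrt (\<Sum>i\<in>UNIV. w i) * norm v"
proof -
  have "(\<Sum>i\<in>UNIV. w i * (norm (v $ i))\<^sup>2) \<le> (\<Sum>i\<in>UNIV. w i * (norm v)\<^sup>2)"
    using assms by (intro sum_mono mult_left_mono power_mono Finite_Cartesian_Product.norm_nth_le) auto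
  then show ?thesis
    unfolding wnorm_def sum_distrib_right[symmetric]
    using real_sqrt_le_mono[of _ "(\<Sum>i\<in>UNIV. w i) * (norm v)\<^sup>2"] by (simp add: real_sqrt_mult)
qed

lemma continuous_on_wnorm: "continuous_on A (wnorm w)"
  unfolding wnorm_def[abs_def] by (intro continuous_intros)

lemma norm_vec_power2: "(norm (v :: 'a::real_normed_vector ^ 'm))\<^sup>2 = (\<Sum>i\<in>UNIV. (norm (v $ i))\<^sup>2)"
  by (simp add: norm_vec_def L2_set_def sum_nonneg)

lemma subspace_direct_sum: "(\<And>i. subspace (V i)) \<Longrightarrow> subspace (direct_sum V)"
  unfolding subspace_def direct_sum_def by auto

lemma complete_direct_sum:
  fixes V :: "'m::finite \<Rightarrow> 'a::real_inner set"
  assumes "\<And>i. Topological_Spaces.complete (V i)"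
  shows "Topological_Spaces.complete (direct_sum V)"
  unfolding complete_def
proof (intro allI impI, elim conjE)
  fix s :: "nat \<Rightarrow> 'a ^ 'm" assume s: "\<forall>n. s n \<in> direct_sum V" and C: "Cauchy s"
  have "\<exists>l\<in>V i. (\<lambda>n. s n $ i) \<longlonglongrightarrow> l" for i
  proof -
    have "Cauchy (\<lambda>n. s n $ i)" using C by (rule Cauchy_vec_nth)
    moreover have "\<forall>n. s n $ i \<in> V i" using s by (simp add: direct_sum_def)
    ultimately show ?thesis using assms[of i, unfolded complete_def, rule_format, of "\<lambda>n. s n $ i"] by simp
  qed
  then obtain l where l: "\<And>i. l i \<in> V i" "\<And>i. (\<lambda>n. s n $ i) \<longlonglongrightarrow> l i" by metis
  have "s \<longlonglongrightarrow> (\<chi> i. l i)" by (rule vec_tendstoI) (simp add: l)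
  moreover have "(\<chi> i. l i) \<in> direct_sum V" using l(1) by (simp add: direct_sum_def)
  ultimately show "\<exists>l\<in>direct_sum V. s \<longlonglongrightarrow> l" by blast
qed

text \<open>The deterministic side of the problem: \<open>P e\<close> is the probability of the mask
  \<open>e\<close>, so expectations over one mask become finite sums and no probability space is
  involved.\<close>

locale block_prox_gradient =
  fixes V :: "'m::finite \<Rightarrow> 'a::real_inner set" and f :: "'a ^ 'm \<Rightarrow> real" and h :: "'m \<Rightarrow> 'a \<Rightarrow> ereal"
    and P :: "('m \<Rightarrow> bool) \<Rightarrow> real" and p \<nu> \<gamma> :: "'m \<Rightarrow> real"
  assumes complete_V: "\<And>i. Topological_Spaces.complete (V i)" and subspace_V: "\<And>i. subspace (V i)"
    and convex_f: "convex_on (direct_sum V) f"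
    and diff_f: "\<And>y. y \<in> direct_sum V \<Longrightarrow> f differentiable (at y within direct_sum V)"
    and proper_h: "\<And>i. proper_on (V i) (h i)"
    and convex_h: "\<And>i. ereal_convex_on (V i) (h i)"
    and lsc_h: "\<And>i. lsc_on (V i) (h i)"
    and P_nonneg: "\<And>e. 0 \<le> P e" and P_sum: "(\<Sum>e\<in>UNIV. P e) = 1"
    and P_marginal: "\<And>i. (\<Sum>e\<in>UNIV. P e * of_bool (e i)) = p i" and p_pos: "\<And>i. 0 < p i"
    and smooth: "\<And>y v. y \<in> direct_sum V \<Longrightarrow> v \<in> direct_sum V \<Longrightarrow>
      (\<Sum>e\<in>UNIV. P e * f (y + e \<odot> v)) \<le> f y + (\<Sum>i\<in>UNIV. p i * (gradient_on (direct_sum V) f y $ i \<bullet> v $ i))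
        + 1/2 * (\<Sum>i\<in>UNIV. p i * \<nu> i * (norm (v $ i))\<^sup>2)"
    and \<nu>_pos: "\<And>i. 0 < \<nu> i" and \<gamma>_pos: "\<And>i. 0 < \<gamma> i" and \<gamma>_less: "\<And>i. \<gamma> i < 2 / \<nu> i"
begin

abbreviation "H \<equiv> direct_sum V"
abbreviation "grad \<equiv> gradient_on (direct_sum V) f"
abbreviation "T \<equiv> fb_step V f h \<gamma>"
text \<open>Real-valued counterparts allow ordinary arithmetic. Since \<open>real_of_ereal\<close>
  sends infinity to 0, they are meaningful only on \<open>domF\<close>.\<close>

definition "hr i z = real_of_ereal (h i z)"
definition "F y = ereal (f y) + (\<Sum>i\<in>UNIV. h i (y $ i))"
definition "Fr y = f y + (\<Sum>i\<in>UNIV. hr i (y $ i))"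
definition "domF = {y. \<forall>i. y $ i \<in> V i \<and> h i (y $ i) \<noteq> \<infinity>}"
definition "\<delta> = (MAX i. \<gamma> i * \<nu> i)"
definition "pmin = (MIN i. p i)"

lemma domF_H: "y \<in> domF \<Longrightarrow> y \<in> H"
  by (simp add: domF_def direct_sum_def)

lemma h_hr: "z \<in> V i \<Longrightarrow> h i z \<noteq> \<infinity> \<Longrightarrow> h i z = ereal (hr i z)"
  using proper_h[of i] by (cases "h i z") (auto simp: hr_def proper_on_def)

lemma F_Fr: "y \<in> domF \<Longrightarrow> F y = ereal (Fr y)"
  by (simp add: F_def Fr_def domF_def h_hr)

lemma F_infinite: "y \<in> H \<Longrightarrow> y \<notin> domF \<Longrightarrow> F y = \<infinity>"
  by (auto simp: F_def domF_def direct_sum_def sum_Pinfty)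

lemma complete_H: "Topological_Spaces.complete H" and subspace_H: "subspace H"
  using complete_direct_sum subspace_direct_sum complete_V subspace_V by blast+

lemma grad: "y \<in> H \<Longrightarrow> (f has_derivative (\<lambda>v. grad y \<bullet> v)) (at y within H)"
  using gradient_on_props[OF complete_H subspace_H _ diff_f] by blast

lemma T_domF: "T y \<in> domF"
  using prox_on_props(1,2)[OF complete_V proper_h convex_h lsc_h \<gamma>_pos]
  by (simp add: domF_def fb_step_def)

text \<open>The proximal variational inequality in block \<open>i\<close>, tested at
  \<open>z\<close>, with the forward step expanded so that the gradient term stands alone.\<close>

lemma T_ineq:
  assumes "z \<in> V i" "h i z \<noteq> \<infinity>"
  shows "hr i (T y $ i) + (grad y $ i) \<bullet> (T y $ i - z)
    \<le> hr i z + (1 / \<gamma> i) * ((T y - y) $ i \<bullet> (z - T y $ i))"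
proof -
  have "hr i (T y $ i) + (1 / \<gamma> i) * ((y $ i - \<gamma> i *\<^sub>R (grad y $ i) - T y $ i) \<bullet> (z - T y $ i)) \<le> hr i z"
    using prox_on_props(3)[OF complete_V proper_h convex_h lsc_h \<gamma>_pos assms]
    by (simp add: fb_step_def hr_def)
  moreover have "(1 / \<gamma> i) * ((y $ i - \<gamma> i *\<^sub>R (grad y $ i) - T y $ i) \<bullet> (z - T y $ i))
    = (grad y $ i) \<bullet> (T y $ i - z) - (1 / \<gamma> i) * ((T y - y) $ i \<bullet> (z - T y $ i))"
    using \<gamma>_pos[of i] by (simp add: inner_add_left inner_diff_left inner_diff_right field_simps)
  ultimately show ?thesis by simp
qed

section \<open>Averaging over the masks\<close>

lemma masked_step_nth: "(y + e \<odot> (T y - y)) $ i = (if e i then T y $ i else y $ i)"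
  by (simp add: mask_def)

lemma masked_step_domF: "y \<in> domF \<Longrightarrow> y + e \<odot> (T y - y) \<in> domF"
  using T_domF[of y] unfolding domF_def by (simp add: masked_step_nth del: vector_add_component)

text \<open>A quantity that looks at one coordinate of the mask sees only the marginal
  \<open>p i\<close>, so the coordinates of a mask may depend on each other arbitrarily.\<close>

lemma expectation_mask: "(\<Sum>e\<in>UNIV. P e * (if e i then a else b)) = b + p i * (a - b)"
proof -
  have "(\<Sum>e\<in>UNIV. P e * (if e i then a else b)) = (\<Sum>e\<in>UNIV. P e * b + P e * of_bool (e i) * (a - b))"
    by (intro sum.cong) (auto simp: algebra_simps)
  also have "\<dots> = b + p i * (a - b)"
    by (simp add: sum.distrib flip: sum_distrib_right add: P_sum P_marginal)
  finally show ?thesis .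
qed

text \<open>The \<open>D\<^sub>i\<close> of the overview: linearized change of \<open>f\<close>,
  exact change of \<open>h i\<close>, and curvature cost when block \<open>i\<close> is
  updated.\<close>

definition decrement :: "'a ^ 'm \<Rightarrow> 'm \<Rightarrow> real" where
  "decrement y i = grad y $ i \<bullet> (T y - y) $ i + hr i (T y $ i) - hr i (y $ i) + \<nu> i / 2 * (norm ((T y - y) $ i))\<^sup>2"

text \<open>The smoothness assumption handles \<open>f\<close>. The remaining part is separable, so
  its expectation is computed exactly, block by block.\<close>

lemma expected_decrease:
  assumes y: "y \<in> domF"
  shows "(\<Sum>e\<in>UNIV. P e * Fr (y + e \<odot> (T y - y))) \<le> Fr y + (\<Sum>i\<in>UNIV. p i * decrement y i)"
proof -
  let ?v = "T y - y"
  have v: "?v \<in> H" using subspace_diff[OF subspace_H domF_H[OF T_domF] domF_H[OF y]] .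
  have "(\<Sum>e\<in>UNIV. P e * Fr (y + e \<odot> ?v)) = (\<Sum>e\<in>UNIV. P e * f (y + e \<odot> ?v))
    + (\<Sum>e\<in>UNIV. \<Sum>i\<in>UNIV. P e * hr i ((y + e \<odot> ?v) $ i))"
    by (simp add: Fr_def distrib_left sum.distrib sum_distrib_left)
  also have "(\<Sum>e\<in>UNIV. \<Sum>i\<in>UNIV. P e * hr i ((y + e \<odot> ?v) $ i))
    = (\<Sum>i\<in>UNIV. \<Sum>e\<in>UNIV. P e * (if e i then hr i (T y $ i) else hr i (y $ i)))"
    by (subst sum.swap) (auto intro!: sum.cong simp: masked_step_nth simp del: vector_add_component)
  also have "\<dots> = (\<Sum>i\<in>UNIV. hr i (y $ i)) + (\<Sum>i\<in>UNIV. p i * (hr i (T y $ i) - hr i (y $ i)))"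
    by (simp add: expectation_mask sum.distrib)
  finally have "(\<Sum>e\<in>UNIV. P e * Fr (y + e \<odot> ?v)) \<le> f y + (\<Sum>i\<in>UNIV. p i * (grad y $ i \<bullet> ?v $ i))
     + 1/2 * (\<Sum>i\<in>UNIV. p i * \<nu> i * (norm (?v $ i))\<^sup>2)
     + ((\<Sum>i\<in>UNIV. hr i (y $ i)) + (\<Sum>i\<in>UNIV. p i * (hr i (T y $ i) - hr i (y $ i))))"
    using smooth[OF domF_H[OF y] v] by simp
  also have "\<dots> = Fr y + (\<Sum>i\<in>UNIV. p i * decrement y i)"
    unfolding Fr_def decrement_def
    by (simp add: distrib_left right_diff_distrib sum.distrib sum_subtractf sum_distrib_left mult_ac)
  finally show ?thesis .
qed

lemma \<delta>_ge: "\<gamma> i * \<nu> i \<le> \<delta>" unfolding \<delta>_def by (rule Max_ge) auto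

section \<open>Bounds on the decrement and their consequences\<close>

lemma \<delta>_less: "\<delta> < 2"
  using \<gamma>_less \<nu>_pos unfolding \<delta>_def by (subst Max_less_iff) (auto simp: field_simps)

lemma pmin_le: "pmin \<le> p i" unfolding pmin_def by (rule Min_le) auto

lemma pmin_pos: "0 < pmin" unfolding pmin_def by (subst Min_gr_iff) (auto simp: p_pos)

lemma p_le_1: "p i \<le> 1"
  unfolding P_marginal[of i, symmetric] P_sum[symmetric]
  by (intro sum_mono) (auto simp: P_nonneg)

lemma pmin_le_1: "pmin \<le> 1" using pmin_le p_le_1 order_trans by blast

lemma half_\<nu>_le: "\<nu> i / 2 \<le> \<delta> / 2 * (1 / \<gamma> i)"
  using \<delta>_ge[of i] \<gamma>_pos[of i] by (simp add: field_simps)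

text \<open>Testing \<open>T_ineq\<close> at the current point gains one full multiple of the
  weighted squared step; the curvature term costs at most \<open>\<delta> / 2\<close> of it.\<close>

lemma decrement_le:
  assumes y: "y \<in> domF"
  shows "decrement y i \<le> - ((2 - \<delta>) / 2) * (1 / \<gamma> i * (norm ((T y - y) $ i))\<^sup>2)"
proof -
  let ?n = "(norm ((T y - y) $ i))\<^sup>2"
  have "hr i (T y $ i) + grad y $ i \<bullet> (T y - y) $ i \<le> hr i (y $ i) - 1 / \<gamma> i * ?n"
    using T_ineq[of "y $ i" i y] y
    by (simp add: domF_def power2_norm_eq_inner inner_diff_left inner_diff_right algebra_simps)
  moreover have "\<nu> i / 2 * ?n \<le> \<delta> / 2 * (1 / \<gamma> i) * ?n" by (rule mult_right_mono[OF half_\<nu>_le]) simp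
  moreover have "(2 - \<delta>) / 2 * (1 / \<gamma> i * ?n) = 1 / \<gamma> i * ?n - \<delta> / 2 * (1 / \<gamma> i) * ?n"
    by (simp add: algebra_simps diff_divide_distrib)
  ultimately show ?thesis unfolding decrement_def by linarith
qed

text \<open>Testing at another point \<open>z\<close> brings in
  \<open>grad y \<bullet> (z - y)\<close>, which convexity of \<open>f\<close> bounds only when all
  blocks are summed with equal weight. Hence the sum is taken without the factors
  \<open>p i\<close>. Cauchy-Schwarz handles the cross term.\<close>

lemma sum_decrement_le:
  assumes y: "y \<in> domF" and z: "z \<in> domF"
  defines "N \<equiv> wnorm (\<lambda>i. 1 / \<gamma> i) (y - T y)"
  shows "(\<Sum>i\<in>UNIV. decrement y i)
    \<le> - (Fr y - Fr z) - (2 - \<delta>) / 2 * N\<^sup>2 + N * wnorm (\<lambda>i. 1 / \<gamma> i) (y - z)"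
proof -
  let ?v = "T y - y"
  let ?w = "\<lambda>i. 1 / \<gamma> i"
  have w: "0 \<le> ?w i" for i using \<gamma>_pos[of i] by simp
  have sw: "wnorm ?w (a - b) = wnorm ?w (b - a)" for a b :: "'a ^ 'm"
    by (simp add: wnorm_def norm_minus_commute)
  have N2: "N\<^sup>2 = (\<Sum>i\<in>UNIV. ?w i * (norm (?v $ i))\<^sup>2)"
    unfolding N_def sw[of y] by (rule wnorm_power2[OF w])
  have i: "decrement y i \<le> hr i (z $ i) - hr i (y $ i) + (grad y $ i) \<bullet> ((z - y) $ i)
    + ?w i * (?v $ i \<bullet> (z - y) $ i) - (2 - \<delta>) / 2 * (?w i * (norm (?v $ i))\<^sup>2)" for i
  proof -
    have "hr i (T y $ i) + (grad y $ i) \<bullet> (T y $ i - z $ i) \<le> hr i (z $ i) + ?w i * (?v $ i \<bullet> (z $ i - T y $ i))"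
      using T_ineq[of "z $ i" i y] z by (simp add: domF_def)
    \<comment> \<open>Splits \<open>z - T y\<close> into \<open>z - y\<close> and the negative of
      the step \<open>?v\<close>.\<close>
    moreover have "?w i * (?v $ i \<bullet> (z $ i - T y $ i)) = ?w i * (?v $ i \<bullet> (z - y) $ i) - ?w i * (norm (?v $ i))\<^sup>2"
      unfolding right_diff_distrib[symmetric]
      by (simp add: power2_norm_eq_inner inner_diff_left inner_diff_right inner_commute)
    moreover have "(grad y $ i) \<bullet> (T y $ i - z $ i) = grad y $ i \<bullet> ?v $ i - grad y $ i \<bullet> (z - y) $ i"
      by (simp add: inner_diff_right)
    moreover have "\<nu> i / 2 * (norm (?v $ i))\<^sup>2 \<le> \<delta> / 2 * ?w i * (norm (?v $ i))\<^sup>2"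
      by (rule mult_right_mono[OF half_\<nu>_le]) simp
    moreover have "(2 - \<delta>) / 2 * (?w i * (norm (?v $ i))\<^sup>2)
        = ?w i * (norm (?v $ i))\<^sup>2 - \<delta> / 2 * ?w i * (norm (?v $ i))\<^sup>2"
      by (simp add: algebra_simps diff_divide_distrib)
    ultimately show ?thesis unfolding decrement_def by linarith
  qed
  have "(\<Sum>i\<in>UNIV. decrement y i) \<le> (\<Sum>i\<in>UNIV. hr i (z $ i) - hr i (y $ i) + (grad y $ i) \<bullet> ((z - y) $ i)
    + ?w i * (?v $ i \<bullet> (z - y) $ i) - (2 - \<delta>) / 2 * (?w i * (norm (?v $ i))\<^sup>2))"
    by (rule sum_mono) (rule i)
  also have "\<dots> = (\<Sum>i\<in>UNIV. hr i (z $ i)) - (\<Sum>i\<in>UNIV. hr i (y $ i)) + grad y \<bullet> (z - y)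
    + (\<Sum>i\<in>UNIV. ?w i * (?v $ i \<bullet> (z - y) $ i)) - (2 - \<delta>) / 2 * N\<^sup>2"
    unfolding N2 inner_vec_def sum_distrib_left by (simp add: sum.distrib sum_subtractf)
  also have "(\<Sum>i\<in>UNIV. ?w i * (?v $ i \<bullet> (z - y) $ i)) \<le> N * wnorm ?w (y - z)"
    unfolding N_def sw[of y] by (rule weighted_inner_le_wnorm[OF w])
  also have "grad y \<bullet> (z - y) \<le> f z - f y"
    using convex_gradient_inequality[OF subspace_H domF_H[OF y] domF_H[OF z] convex_f grad[OF domF_H[OF y]]]
    by simp
  finally show ?thesis by (simp add: Fr_def)
qed

text \<open>Gives the linear rate for the masked step before the acceptance test.\<close>

lemma expected_contraction:
  assumes y: "y \<in> domF" and S: "S \<noteq> {}" "\<And>z. z \<in> S \<Longrightarrow> z \<in> domF \<and> Fr z = Fmin"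
    and c: "0 < c" and err: "wdist (\<lambda>i. 1 / \<gamma> i) y S \<le> c * wnorm (\<lambda>i. 1 / \<gamma> i) (y - T y)"
  shows "(\<Sum>e\<in>UNIV. P e * (Fr (y + e \<odot> (T y - y)) - Fmin))
    \<le> (1 - pmin * min 1 ((2 - \<delta>) / (2 * c))) * (Fr y - Fmin)"
proof -
  let ?w = "\<lambda>i. 1 / \<gamma> i"
  define N where "N = wnorm ?w (y - T y)"
  define a where "a = (2 - \<delta>) / 2"
  \<comment> \<open>Chosen as the largest weight in the unit interval with
    \<open>\<theta> * c \<le> a\<close>, so that the coefficient \<open>\<theta> * c - a\<close> of
    \<open>N\<^sup>2\<close> is nonpositive.\<close>
  define \<theta> where "\<theta> = min 1 (a / c)"
  define \<Sigma> where "\<Sigma> = (\<Sum>i\<in>UNIV. decrement y i)"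
  have w: "0 \<le> ?w i" for i using \<gamma>_pos[of i] by simp
  have a: "0 < a" using \<delta>_less by (simp add: a_def)
  have \<theta>: "0 < \<theta>" "\<theta> \<le> 1" "\<theta> * c \<le> a" using a c by (auto simp: \<theta>_def min_def field_simps)
  have N: "0 \<le> N" unfolding N_def by (rule wnorm_nonneg[OF w])
  have A: "\<Sigma> \<le> - a * N\<^sup>2"
  proof -
    have "\<Sigma> \<le> (\<Sum>i\<in>UNIV. - a * (?w i * (norm ((T y - y) $ i))\<^sup>2))"
      unfolding \<Sigma>_def a_def by (rule sum_mono) (rule decrement_le[OF y])
    also have "\<dots> = - a * N\<^sup>2"
      unfolding N_def wnorm_power2[OF w] sum_distrib_left by (simp add: norm_minus_commute)
    finally show ?thesis .
  qed
  have each: "\<Sigma> + (Fr y - Fmin) + a * N\<^sup>2 \<le> N * wnorm ?w (y - z)" if "z \<in> S" for z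
    using sum_decrement_le[OF y, of z] S(2)[OF that] unfolding \<Sigma>_def a_def N_def by simp
  \<comment> \<open>The infimum in \<open>wdist\<close> may not be attained, so the bound for each
    \<open>z\<close> is divided by \<open>N\<close> before passing to the infimum;
    \<open>N = 0\<close> is treated separately.\<close>
  have B: "\<Sigma> + (Fr y - Fmin) + a * N\<^sup>2 \<le> N * (c * N)"
  proof (cases "N = 0")
    case True
    then show ?thesis using each S(1) by fastforce
  next
    case False
    then have N0: "0 < N" using N by simp
    have "(\<Sigma> + (Fr y - Fmin) + a * N\<^sup>2) / N \<le> wdist ?w y S"
      unfolding wdist_def using S(1) each N0 by (intro cINF_greatest) (auto simp: field_simps)
    then have "(\<Sigma> + (Fr y - Fmin) + a * N\<^sup>2) / N \<le> c * N" using err by (simp add: N_def)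
    then show ?thesis using N0 by (simp add: field_simps)
  qed
  have "\<Sigma> = (1 - \<theta>) * \<Sigma> + \<theta> * \<Sigma>" by (simp add: algebra_simps)
  also have "\<dots> \<le> (1 - \<theta>) * (- a * N\<^sup>2) + \<theta> * (N * (c * N) - (Fr y - Fmin) - a * N\<^sup>2)"
    using A B \<theta> by (intro add_mono mult_left_mono) auto
  also have "\<dots> = (\<theta> * c - a) * N\<^sup>2 - \<theta> * (Fr y - Fmin)" by (simp add: algebra_simps power2_eq_square)
  also have "\<dots> \<le> - \<theta> * (Fr y - Fmin)" using \<theta>(3) by (simp add: mult_nonpos_nonneg)
  finally have \<Sigma>_le: "\<Sigma> \<le> - \<theta> * (Fr y - Fmin)" .
  have neg: "decrement y i \<le> 0" for i
  proof -
    have "0 \<le> a * (1 / \<gamma> i * (norm ((T y - y) $ i))\<^sup>2)" using a w[of i] by simp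
    then show ?thesis using decrement_le[OF y, of i] unfolding a_def by linarith
  qed
  have "(\<Sum>e\<in>UNIV. P e * (Fr (y + e \<odot> (T y - y)) - Fmin)) = (\<Sum>e\<in>UNIV. P e * Fr (y + e \<odot> (T y - y))) - Fmin"
    by (simp add: right_diff_distrib sum_subtractf P_sum flip: sum_distrib_right)
  also have "\<dots> \<le> Fr y - Fmin + (\<Sum>i\<in>UNIV. p i * decrement y i)" using expected_decrease[OF y] by simp
  \<comment> \<open>Since each decrement is nonpositive, lowering \<open>p i\<close> to
    \<open>pmin\<close> can only raise the sum; this restores the equal weights.\<close>
  also have "(\<Sum>i\<in>UNIV. p i * decrement y i) \<le> (\<Sum>i\<in>UNIV. pmin * decrement y i)"
    by (intro sum_mono mult_right_mono_neg pmin_le neg)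
  also have "\<dots> = pmin * \<Sigma>" by (simp add: \<Sigma>_def sum_distrib_left)
  also have "\<dots> \<le> pmin * (- \<theta> * (Fr y - Fmin))" using \<Sigma>_le pmin_pos by (intro mult_left_mono) auto
  also have "Fr y - Fmin + pmin * (- \<theta> * (Fr y - Fmin)) = (1 - pmin * \<theta>) * (Fr y - Fmin)"
    by (simp add: algebra_simps)
  also have "\<theta> = min 1 ((2 - \<delta>) / (2 * c))" by (simp add: \<theta>_def a_def)
  finally show ?thesis by simp
qed

text \<open>The expected value cannot fall below \<open>Fmin\<close>, so the guaranteed decrease, a
  multiple of the squared step, is at most the current gap.\<close>

lemma expected_step_bound:
  assumes y: "y \<in> domF" and min: "\<And>z. z \<in> domF \<Longrightarrow> Fmin \<le> Fr z"
  shows "(\<Sum>e\<in>UNIV. P e * (norm (e \<odot> (T y - y)))\<^sup>2) \<le> (2 / (2 - \<delta>) * (\<Sum>i\<in>UNIV. \<gamma> i)) * (Fr y - Fmin)"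
proof -
  let ?v = "T y - y"
  define a where "a = (2 - \<delta>) / 2"
  have a: "0 < a" using \<delta>_less by (simp add: a_def)
  have "Fmin = (\<Sum>e\<in>UNIV. P e * Fmin)" by (simp add: P_sum flip: sum_distrib_right)
  also have "\<dots> \<le> (\<Sum>e\<in>UNIV. P e * Fr (y + e \<odot> ?v))"
    using y by (intro sum_mono mult_left_mono min P_nonneg masked_step_domF)
  also have "\<dots> \<le> Fr y + (\<Sum>i\<in>UNIV. p i * decrement y i)" by (rule expected_decrease[OF y])
  also have "(\<Sum>i\<in>UNIV. p i * decrement y i) \<le> (\<Sum>i\<in>UNIV. p i * (- a * (1 / \<gamma> i * (norm (?v $ i))\<^sup>2)))"
    unfolding a_def using p_pos by (intro sum_mono mult_left_mono decrement_le y) (auto simp: less_imp_le)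
  also have "\<dots> = - a * (\<Sum>i\<in>UNIV. p i / \<gamma> i * (norm (?v $ i))\<^sup>2)"
    unfolding sum_distrib_left by (intro sum.cong) auto
  finally have main: "a * (\<Sum>i\<in>UNIV. p i / \<gamma> i * (norm (?v $ i))\<^sup>2) \<le> Fr y - Fmin" by simp
  have "(\<Sum>e\<in>UNIV. P e * (norm (e \<odot> ?v))\<^sup>2) = (\<Sum>e\<in>UNIV. \<Sum>i\<in>UNIV. P e * (if e i then (norm (?v $ i))\<^sup>2 else 0))"
    by (auto simp: norm_vec_power2 sum_distrib_left mask_def intro!: sum.cong)
  also have "\<dots> = (\<Sum>i\<in>UNIV. p i * (norm (?v $ i))\<^sup>2)"
    by (subst sum.swap) (simp add: expectation_mask)
  also have "\<dots> \<le> (\<Sum>i\<in>UNIV. (\<Sum>i\<in>UNIV. \<gamma> i) * (p i / \<gamma> i * (norm (?v $ i))\<^sup>2))"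
  proof (rule sum_mono)
    fix i
    \<comment> \<open>A crude passage from weights \<open>p i / \<gamma> i\<close> to
      \<open>p i\<close>; it affects the constant but not the rate.\<close>
    have "\<gamma> i \<le> (\<Sum>i\<in>UNIV. \<gamma> i)" using \<gamma>_pos by (intro member_le_sum) (auto simp: less_imp_le)
    then have "\<gamma> i * (p i / \<gamma> i * (norm (?v $ i))\<^sup>2) \<le> (\<Sum>i\<in>UNIV. \<gamma> i) * (p i / \<gamma> i * (norm (?v $ i))\<^sup>2)"
      using p_pos[of i] \<gamma>_pos[of i] by (intro mult_right_mono) auto
    then show "p i * (norm (?v $ i))\<^sup>2 \<le> (\<Sum>i\<in>UNIV. \<gamma> i) * (p i / \<gamma> i * (norm (?v $ i))\<^sup>2)"
      using \<gamma>_pos[of i] by simp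
  qed
  also have "\<dots> = (\<Sum>i\<in>UNIV. \<gamma> i) * (\<Sum>i\<in>UNIV. p i / \<gamma> i * (norm (?v $ i))\<^sup>2)" by (simp add: sum_distrib_left)
  also have "\<dots> \<le> (\<Sum>i\<in>UNIV. \<gamma> i) * ((Fr y - Fmin) / a)"
    using main a \<gamma>_pos by (intro mult_left_mono sum_nonneg) (auto simp: field_simps less_imp_le)
  also have "\<dots> = (2 / (2 - \<delta>) * (\<Sum>i\<in>UNIV. \<gamma> i)) * (Fr y - Fmin)" by (simp add: a_def)
  finally show ?thesis .
qed

text \<open>\<open>f\<close> is continuous along the sequence, and each \<open>h i\<close> is
  eventually above any real number below its value at the limit. The argument works with such real
  lower bounds because \<open>z\<close> is not yet known to lie in \<open>domF\<close>.\<close>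

lemma Fr_lsc:
  assumes s: "\<And>k. s k \<in> domF" "s \<longlonglongrightarrow> z" and lim: "(\<lambda>k. Fr (s k)) \<longlonglongrightarrow> l"
  shows "z \<in> domF" and "Fr z \<le> l"
proof -
  have zH: "z \<in> H" using closed_sequentially[OF complete_imp_closed[OF complete_H] domF_H[OF s(1)] s(2)] .
  have zV: "z $ i \<in> V i" for i using zH by (simp add: direct_sum_def)
  have f_lim: "(\<lambda>k. f (s k)) \<longlonglongrightarrow> f z"
    using differentiable_imp_continuous_within[OF diff_f[OF zH]] s(2) domF_H[OF s(1)]
    unfolding continuous_within_sequentially comp_def by blast
  \<comment> \<open>Used twice: with a huge bound in one block to exclude infinite values, and with
    bounds close to \<open>hr i (z $ i)\<close> for the inequality.\<close>
  have sum_le: "(\<Sum>i\<in>UNIV. C i) \<le> l - f z" if C: "\<And>i. ereal (C i) < h i (z $ i)" for C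
  proof (rule tendsto_lowerbound)
    show "(\<lambda>k. Fr (s k) - f (s k)) \<longlonglongrightarrow> l - f z" by (intro tendsto_intros lim f_lim)
    have "\<forall>\<^sub>F k in sequentially. ereal (C i) < h i (s k $ i)" for i
      using s zV C by (intro lsc_on_eventually_less[OF lsc_h]) (auto simp: domF_def intro: tendsto_vec_nth)
    then have "\<forall>\<^sub>F k in sequentially. \<forall>i. ereal (C i) < h i (s k $ i)" by (simp add: eventually_all_finite)
    then show "\<forall>\<^sub>F k in sequentially. (\<Sum>i\<in>UNIV. C i) \<le> Fr (s k) - f (s k)"
    proof eventually_elim
      case (elim k)
      have "C i \<le> hr i (s k $ i)" for i
      proof -
        have "h i (s k $ i) = ereal (hr i (s k $ i))" using s(1)[of k] h_hr by (simp add: domF_def)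
        then show ?thesis using elim by (metis less_ereal.simps(1) less_imp_le)
      qed
      then show ?case by (simp add: Fr_def sum_mono)
    qed
  qed simp
  have "\<exists>C. ereal C < h i (z $ i)" for i
    using ereal_dense2[of "-\<infinity>" "h i (z $ i)"] proper_h[of i] zV[of i] by (auto simp: proper_on_def)
  then obtain C0 where C0: "\<And>i. ereal (C0 i) < h i (z $ i)" by metis
  show dom: "z \<in> domF"
  proof (rule ccontr)
    assume "z \<notin> domF"
    then obtain j where j: "h j (z $ j) = \<infinity>" using zV by (auto simp: domF_def)
    \<comment> \<open>Makes the total of the lower bounds equal to \<open>l - f z + 1\<close>,
      contradicting \<open>sum_le\<close>; an infinite value at \<open>j\<close> admits any such
      \<open>b\<close>.\<close>
    define b where "b = l - f z - (\<Sum>i\<in>UNIV-{j}. C0 i) + 1"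
    have "(\<Sum>i\<in>UNIV. (C0(j := b)) i) \<le> l - f z"
      using C0 j by (intro sum_le) auto
    moreover have "(\<Sum>i\<in>UNIV. (C0(j := b)) i) = b + (\<Sum>i\<in>UNIV-{j}. C0 i)"
      by (subst sum.remove[of _ j]) (auto intro!: sum.cong)
    ultimately show False by (simp add: b_def)
  qed
  have "(\<Sum>i\<in>UNIV. hr i (z $ i)) \<le> l - f z + e" if e: "0 < e" for e
  proof -
    have card: "0 < CARD('m)" by simp
    have "(\<Sum>i\<in>UNIV. hr i (z $ i) - e / CARD('m)) \<le> l - f z"
    proof (rule sum_le)
      fix i
      have "h i (z $ i) = ereal (hr i (z $ i))" using dom h_hr by (simp add: domF_def)
      then show "ereal (hr i (z $ i) - e / CARD('m)) < h i (z $ i)" using e card by simp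
    qed
    then show ?thesis by (simp add: sum_subtractf)
  qed
  then have "(\<Sum>i\<in>UNIV. hr i (z $ i)) \<le> l - f z" by (rule field_le_epsilon)
  then show "Fr z \<le> l" by (simp add: Fr_def)
qed

end

section \<open>Random iterations driven by independent finite-valued variables\<close>

context prob_space
begin

text \<open>Measurability into a finite discrete space makes every real function \<open>g\<close> of
  \<open>X\<close> measurable and bounded, with no topology on the value type.\<close>

lemma integrable_finite_valued:
  fixes g :: "'b \<Rightarrow> real"
  assumes X: "X \<in> measurable M (count_space R)" and R: "finite R"
  shows "integrable M (\<lambda>\<omega>. g (X \<omega>))"
proof (rule integrable_const_bound[where B = "\<Sum>r\<in>R. \<bar>g r\<bar>"])
  show "(\<lambda>\<omega>. g (X \<omega>)) \<in> borel_measurable M"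
    using measurable_compose[OF X, of g borel] by simp
  show "AE \<omega> in M. norm (g (X \<omega>)) \<le> (\<Sum>r\<in>R. \<bar>g r\<bar>)"
  proof (rule AE_I2)
    fix \<omega> assume "\<omega> \<in> space M"
    then have "X \<omega> \<in> R" using measurable_space[OF X] by simp
    then show "norm (g (X \<omega>)) \<le> (\<Sum>r\<in>R. \<bar>g r\<bar>)"
      using member_le_sum[of "X \<omega>" R "\<lambda>r. \<bar>g r\<bar>"] R by simp
  qed
qed

lemma expectation_finite_type:
  fixes g :: "'e::finite \<Rightarrow> real"
  assumes X: "X \<in> measurable M (count_space UNIV)"
  shows "expectation (\<lambda>\<omega>. g (X \<omega>)) = (\<Sum>e\<in>UNIV. prob {\<omega> \<in> space M. X \<omega> = e} * g e)"
proof -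
  have m: "{\<omega> \<in> space M. X \<omega> = e} \<in> events" for e
    using measurable_sets[OF X, of "{e}"] by (simp add: vimage_def Int_def conj_commute)
  have "expectation (\<lambda>\<omega>. g (X \<omega>))
    = expectation (\<lambda>\<omega>. \<Sum>e\<in>UNIV. indicator {\<omega> \<in> space M. X \<omega> = e} \<omega> * g e)"
    by (rule Bochner_Integration.integral_cong) (auto simp: indicator_def of_bool_def if_distrib[of "\<lambda>x. x * _"] cong: if_cong)
  also have "\<dots> = (\<Sum>e\<in>UNIV. expectation (\<lambda>\<omega>. indicator {\<omega> \<in> space M. X \<omega> = e} \<omega> * g e))"
    using m by (intro Bochner_Integration.integral_sum integrable_mult_left integrable_real_indicator) (auto simp: emeasure_eq_measure)
  also have "\<dots> = (\<Sum>e\<in>UNIV. prob {\<omega> \<in> space M. X \<omega> = e} * g e)"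
    using m by (intro sum.cong) (auto simp: Int_absorb2)
  finally show ?thesis .
qed

end

text \<open>A stochastic recursion with deterministic start. That \<open>P\<close> does not depend
  on \<open>n\<close> expresses identical distribution.\<close>

locale random_iteration = prob_space M for M :: "'w measure" +
  fixes eps :: "nat \<Rightarrow> 'w \<Rightarrow> 'e::finite" and P :: "'e \<Rightarrow> real"
    and G :: "'e \<Rightarrow> 's \<Rightarrow> 's" and x :: "nat \<Rightarrow> 'w \<Rightarrow> 's" and x0 :: 's
  assumes indep: "indep_vars (\<lambda>_. count_space UNIV) eps UNIV"
    and P: "\<And>n e. prob {\<omega> \<in> space M. eps n \<omega> = e} = P e"
    and x_0: "\<And>\<omega>. \<omega> \<in> space M \<Longrightarrow> x 0 \<omega> = x0"
    and x_Suc: "\<And>n \<omega>. \<omega> \<in> space M \<Longrightarrow> x (Suc n) \<omega> = G (eps n \<omega>) (x n \<omega>)"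
begin

text \<open>The state as an explicit function of the noise. \<open>path n\<close> reads only the
  entries below \<open>n\<close>, which makes it independent of \<open>eps n\<close>.\<close>

primrec path :: "nat \<Rightarrow> (nat \<Rightarrow> 'e) \<Rightarrow> 's" where
  "path 0 w = x0"
| "path (Suc n) w = G (w n) (path n w)"

text \<open>Finite because the noise type is finite; it serves as the discrete codomain of
  \<open>x n\<close>.\<close>

primrec reachable :: "nat \<Rightarrow> 's set" where
  "reachable 0 = {x0}"
| "reachable (Suc n) = (\<Union>e. G e ` reachable n)"

lemma finite_reachable: "finite (reachable n)"
  by (induction n) auto

lemma x_eq_path: "\<omega> \<in> space M \<Longrightarrow> x n \<omega> = path n (\<lambda>k\<in>{..<n}. eps k \<omega>)"
proof -
  assume \<omega>: "\<omega> \<in> space M"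
  \<comment> \<open>The horizon \<open>k\<close> stays fixed during the induction, since restricting
    to \<open>{..<n}\<close> would change the argument of \<open>path\<close> at each step.\<close>
  have "n \<le> k \<Longrightarrow> x n \<omega> = path n (\<lambda>j\<in>{..<k}. eps j \<omega>)" for k
    by (induction n) (auto simp: x_0 x_Suc \<omega>)
  then show ?thesis by blast
qed

lemma path_measurable:
  "n \<le> k \<Longrightarrow> path n \<in> measurable (PiM {..<k} (\<lambda>_. count_space UNIV)) (count_space (reachable n))"
proof (induction n)
  case (Suc n)
  have comp: "(\<lambda>w. w n) \<in> measurable (PiM {..<k} (\<lambda>_. count_space (UNIV :: 'e set))) (count_space UNIV)"
    using Suc by (intro measurable_component_singleton) auto
  have "(\<lambda>w. G e (path n w)) \<in> measurable (PiM {..<k} (\<lambda>_. count_space UNIV)) (count_space (reachable (Suc n)))" for e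
    using Suc by (intro measurable_compose[OF Suc.IH]) auto
  then have "(\<lambda>w. G (w n) (path n w)) \<in> measurable (PiM {..<k} (\<lambda>_. count_space UNIV)) (count_space (reachable (Suc n)))"
    by (rule measurable_compose_countable'[where I = UNIV and g = "\<lambda>w. w n"])
      (use comp in \<open>auto simp: countable_finite\<close>)
  then show ?case by simp
qed (simp add: path.simps(1)[abs_def])

lemma eps_measurable: "eps n \<in> measurable M (count_space UNIV)"
  using indep by (simp add: indep_vars_def2)

lemma x_measurable: "x n \<in> measurable M (count_space (reachable n))"
proof -
  have "(\<lambda>\<omega>. path n (\<lambda>k\<in>{..<n}. eps k \<omega>)) \<in> measurable M (count_space (reachable n))"
    by (intro measurable_compose[OF _ path_measurable[of n n]] measurable_restrict eps_measurable order_refl)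
  then show ?thesis by (subst measurable_cong[OF x_eq_path])
qed

lemma integrable_fun: "integrable M (\<lambda>\<omega>. g (x n \<omega>))" for g :: "'s \<Rightarrow> real"
  by (rule integrable_finite_valued[OF x_measurable finite_reachable])

text \<open>Splitting by the finitely many values of \<open>x n\<close> replaces joint
  measurability, which would otherwise call for a countable base of the state space.\<close>

lemma measurable_fun_x:
  assumes "\<And>y. y \<in> reachable n \<Longrightarrow> (\<lambda>\<omega>. g y \<omega>) \<in> measurable M N"
  shows "(\<lambda>\<omega>. g (x n \<omega>) \<omega>) \<in> measurable M N"
  using assms x_measurable countable_finite[OF finite_reachable] by (rule measurable_compose_countable')

lemma integrable_fun_eps: "integrable M (\<lambda>\<omega>. g (eps n \<omega>) (x n \<omega>))" for g :: "'e \<Rightarrow> 's \<Rightarrow> real"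
proof -
  have "(\<lambda>\<omega>. (eps n \<omega>, x n \<omega>)) \<in> measurable M (count_space (UNIV \<times> reachable n))"
    by (rule measurable_fun_x) (auto intro: measurable_compose[OF eps_measurable])
  from integrable_finite_valued[OF this, of "\<lambda>(e, y). g e y"] show ?thesis
    by (simp add: finite_reachable)
qed

text \<open>Splitting by the value of \<open>eps n\<close> and using its independence from the
  earlier noise replaces conditioning on the past.\<close>

lemma expectation_step:
  fixes g :: "'e \<Rightarrow> 's \<Rightarrow> real"
  shows "expectation (\<lambda>\<omega>. g (eps n \<omega>) (x n \<omega>)) = (\<Sum>e\<in>UNIV. P e * expectation (\<lambda>\<omega>. g e (x n \<omega>)))"
proof -
  have indep_e: "expectation (\<lambda>\<omega>. of_bool (eps n \<omega> = e) * g e (x n \<omega>)) = P e * expectation (\<lambda>\<omega>. g e (x n \<omega>))" for e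
  proof -
    let ?N = "\<lambda>_::nat. count_space (UNIV :: 'e set)"
    have 1: "indep_var (PiM {n} ?N) (\<lambda>\<omega>. \<lambda>k\<in>{n}. eps k \<omega>) (PiM {..<n} ?N) (\<lambda>\<omega>. \<lambda>k\<in>{..<n}. eps k \<omega>)"
      by (rule indep_var_restrict[OF indep]) auto
    have a: "(\<lambda>w. of_bool (w n = e) :: real) \<in> borel_measurable (PiM {n} ?N)"
    proof -
      have "(\<lambda>w. w n) \<in> measurable (PiM {n} ?N) (count_space UNIV)"
        by (rule measurable_component_singleton) auto
      then show ?thesis by (rule measurable_compose[where g = "\<lambda>u. of_bool (u = e)"]) simp
    qed
    have b: "(\<lambda>w. g e (path n w)) \<in> borel_measurable (PiM {..<n} ?N)"
      by (rule measurable_compose[OF path_measurable[OF order_refl]]) simp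
    have "indep_var borel (\<lambda>\<omega>. of_bool (eps n \<omega> = e) :: real) borel (\<lambda>\<omega>. g e (path n (\<lambda>k\<in>{..<n}. eps k \<omega>)))"
      using indep_var_compose[OF 1 a b] by (simp add: comp_def)
    moreover have "integrable M (\<lambda>\<omega>. of_bool (eps n \<omega> = e) :: real)"
      by (rule integrable_finite_valued[OF eps_measurable]) simp
    moreover have "integrable M (\<lambda>\<omega>. g e (path n (\<lambda>k\<in>{..<n}. eps k \<omega>)))"
      by (rule iffD1[OF Bochner_Integration.integrable_cong[OF refl] integrable_fun[of "g e" n]]) (simp add: x_eq_path)
    ultimately have "expectation (\<lambda>\<omega>. of_bool (eps n \<omega> = e) * g e (path n (\<lambda>k\<in>{..<n}. eps k \<omega>)))
      = expectation (\<lambda>\<omega>. of_bool (eps n \<omega> = e)) * expectation (\<lambda>\<omega>. g e (path n (\<lambda>k\<in>{..<n}. eps k \<omega>)))"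
      by (rule indep_var_lebesgue_integral)
    moreover have "expectation (\<lambda>\<omega>. of_bool (eps n \<omega> = e)) = P e"
      using expectation_finite_type[OF eps_measurable, of "\<lambda>u. of_bool (u = e)" n]
      by (simp add: P if_distrib[of "\<lambda>x. _ * x"] of_bool_def cong: if_cong)
    moreover have "expectation (\<lambda>\<omega>. of_bool (eps n \<omega> = e) * g e (path n (\<lambda>k\<in>{..<n}. eps k \<omega>))) = expectation (\<lambda>\<omega>. of_bool (eps n \<omega> = e) * g e (x n \<omega>))"
      by (rule Bochner_Integration.integral_cong) (auto simp: x_eq_path)
    moreover have "expectation (\<lambda>\<omega>. g e (path n (\<lambda>k\<in>{..<n}. eps k \<omega>))) = expectation (\<lambda>\<omega>. g e (x n \<omega>))"
      by (rule Bochner_Integration.integral_cong) (auto simp: x_eq_path)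
    ultimately show ?thesis by simp
  qed
  have "expectation (\<lambda>\<omega>. g (eps n \<omega>) (x n \<omega>)) = expectation (\<lambda>\<omega>. \<Sum>e\<in>UNIV. of_bool (eps n \<omega> = e) * g e (x n \<omega>))"
    by (rule Bochner_Integration.integral_cong) (auto simp: of_bool_def if_distrib[of "\<lambda>x. x * _"] cong: if_cong)
  also have "\<dots> = (\<Sum>e\<in>UNIV. expectation (\<lambda>\<omega>. of_bool (eps n \<omega> = e) * g e (x n \<omega>)))"
    by (rule Bochner_Integration.integral_sum) (rule integrable_fun_eps[of "\<lambda>u y. of_bool (u = _) * g _ y"])
  also have "\<dots> = (\<Sum>e\<in>UNIV. P e * expectation (\<lambda>\<omega>. g e (x n \<omega>)))" by (simp add: indep_e)
  finally show ?thesis .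
qed

text \<open>Lets a deterministic bound on the average over one noise value be integrated along the
  iteration.\<close>

lemma expectation_step_le:
  fixes g :: "'e \<Rightarrow> 's \<Rightarrow> real" and k :: "'s \<Rightarrow> real"
  assumes "\<And>\<omega>. \<omega> \<in> space M \<Longrightarrow> (\<Sum>e\<in>UNIV. P e * g e (x n \<omega>)) \<le> k (x n \<omega>)"
  shows "expectation (\<lambda>\<omega>. g (eps n \<omega>) (x n \<omega>)) \<le> expectation (\<lambda>\<omega>. k (x n \<omega>))"
proof -
  have "expectation (\<lambda>\<omega>. g (eps n \<omega>) (x n \<omega>)) = expectation (\<lambda>\<omega>. \<Sum>e\<in>UNIV. P e * g e (x n \<omega>))"
    unfolding expectation_step
    by (subst Bochner_Integration.integral_sum) (auto intro: integrable_fun)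
  also have "\<dots> \<le> expectation (\<lambda>\<omega>. k (x n \<omega>))"
    using integrable_fun[of "\<lambda>y. \<Sum>e\<in>UNIV. P e * g e y"] integrable_fun[of k] assms by (intro integral_mono)
  finally show ?thesis .
qed

end

section \<open>Almost sure convergence from contraction in expectation\<close>

lemma (in prob_space) expectation_le_sqrt:
  fixes X :: "'a \<Rightarrow> real"
  assumes "integrable M X" "integrable M (\<lambda>\<omega>. (X \<omega>)\<^sup>2)"
  shows "expectation X \<le> sqrt (expectation (\<lambda>\<omega>. (X \<omega>)\<^sup>2))"
proof -
  have "0 \<le> variance X" by (rule variance_positive)
  then show ?thesis using variance_eq[OF assms] by (intro real_le_rsqrt) simp
qed

text \<open>\<open>\<Phi>\<close> plays the role of the optimality gap and \<open>K\<close> of the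
  initial sublevel set. Completeness and lower semicontinuity enter only through
  \<open>limit_in_S\<close>, so the state space is just metric.\<close>

locale random_descent = random_iteration M eps P G x x0
  for M :: "'w measure" and eps :: "nat \<Rightarrow> 'w \<Rightarrow> 'e::finite" and P
    and G :: "'e \<Rightarrow> 's::metric_space \<Rightarrow> 's" and x x0 +
  fixes K S :: "'s set" and \<Phi> :: "'s \<Rightarrow> real" and q B :: real
  assumes x0_K: "x0 \<in> K" and G_K: "\<And>e y. y \<in> K \<Longrightarrow> G e y \<in> K"
    and \<Phi>_nonneg: "\<And>y. y \<in> K \<Longrightarrow> 0 \<le> \<Phi> y"
    and contraction: "\<And>y. y \<in> K \<Longrightarrow> (\<Sum>e\<in>UNIV. P e * \<Phi> (G e y)) \<le> q * \<Phi> y"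
    and step_bound: "\<And>y. y \<in> K \<Longrightarrow> (\<Sum>e\<in>UNIV. P e * (dist y (G e y))\<^sup>2) \<le> B * \<Phi> y"
    and q: "0 \<le> q" "q < 1" and B: "0 \<le> B"
    and limit_in_S: "\<And>s. (\<And>k. s k \<in> K) \<Longrightarrow> Cauchy s \<Longrightarrow> (\<lambda>k. \<Phi> (s k)) \<longlonglongrightarrow> 0 \<Longrightarrow> \<exists>z\<in>S. s \<longlonglongrightarrow> z"
    and S_ne: "S \<noteq> {}"
begin

lemma x_K: "\<omega> \<in> space M \<Longrightarrow> x n \<omega> \<in> K"
  by (induction n) (auto simp: x_0 x_Suc x0_K G_K)

lemma expectation_le_power: "expectation (\<lambda>\<omega>. \<Phi> (x n \<omega>)) \<le> q ^ n * \<Phi> x0"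
proof (induction n)
  case 0
  have "expectation (\<lambda>\<omega>. \<Phi> (x 0 \<omega>)) = expectation (\<lambda>\<omega>. \<Phi> x0)"
    by (rule Bochner_Integration.integral_cong) (auto simp: x_0)
  then show ?case by (simp add: prob_space)
next
  case (Suc n)
  have "expectation (\<lambda>\<omega>. \<Phi> (x (Suc n) \<omega>)) = expectation (\<lambda>\<omega>. \<Phi> (G (eps n \<omega>) (x n \<omega>)))"
    by (rule Bochner_Integration.integral_cong) (auto simp: x_Suc)
  also have "\<dots> \<le> expectation (\<lambda>\<omega>. q * \<Phi> (x n \<omega>))"
    by (rule expectation_step_le) (auto simp: contraction x_K)
  also have "\<dots> = q * expectation (\<lambda>\<omega>. \<Phi> (x n \<omega>))" by simp
  also have "\<dots> \<le> q * (q ^ n * \<Phi> x0)" by (intro mult_left_mono Suc q)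
  finally show ?case by simp
qed

lemma integrable_increment: "integrable M (\<lambda>\<omega>. g (x n \<omega>) (x (Suc n) \<omega>))" for g :: "'s \<Rightarrow> 's \<Rightarrow> real"
  by (rule iffD1[OF Bochner_Integration.integrable_cong[OF refl] integrable_fun_eps[of "\<lambda>e y. g y (G e y)" n]])
    (simp add: x_Suc)

text \<open>The step bound controls the second moment by the gap; taking square roots halves the
  exponent of \<open>q\<close>.\<close>

lemma expectation_increment:
  "expectation (\<lambda>\<omega>. dist (x n \<omega>) (x (Suc n) \<omega>)) \<le> sqrt (B * \<Phi> x0) * sqrt q ^ n"
proof -
  have "expectation (\<lambda>\<omega>. (dist (x n \<omega>) (x (Suc n) \<omega>))\<^sup>2) = expectation (\<lambda>\<omega>. (dist (x n \<omega>) (G (eps n \<omega>) (x n \<omega>)))\<^sup>2)"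
    by (rule Bochner_Integration.integral_cong) (auto simp: x_Suc)
  also have "\<dots> \<le> expectation (\<lambda>\<omega>. B * \<Phi> (x n \<omega>))"
    by (rule expectation_step_le[where g = "\<lambda>e y. (dist y (G e y))\<^sup>2"]) (auto simp: step_bound x_K)
  also have "\<dots> = B * expectation (\<lambda>\<omega>. \<Phi> (x n \<omega>))" by simp
  also have "\<dots> \<le> B * (q ^ n * \<Phi> x0)" by (intro mult_left_mono expectation_le_power B)
  finally have "expectation (\<lambda>\<omega>. (dist (x n \<omega>) (x (Suc n) \<omega>))\<^sup>2) \<le> B * (q ^ n * \<Phi> x0)" .
  then have "sqrt (expectation (\<lambda>\<omega>. (dist (x n \<omega>) (x (Suc n) \<omega>))\<^sup>2)) \<le> sqrt (B * (q ^ n * \<Phi> x0))" by simp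
  also have "\<dots> = sqrt (B * \<Phi> x0) * sqrt q ^ n" by (simp add: real_sqrt_mult real_sqrt_power)
  finally show ?thesis
    using expectation_le_sqrt[of "\<lambda>\<omega>. dist (x n \<omega>) (x (Suc n) \<omega>)"]
      integrable_increment[of dist n] integrable_increment[of "\<lambda>y z. (dist y z)\<^sup>2" n] by linarith
qed

text \<open>Increments and gaps have summable expectations, so both series converge almost surely.
  There the path is Cauchy with vanishing gap, and the expected tail of the increments bounds the
  distance to the limit.\<close>

theorem convergence:
  obtains xstar C where "xstar \<in> borel_measurable M" "\<And>\<omega>. \<omega> \<in> space M \<Longrightarrow> xstar \<omega> \<in> S"
    "AE \<omega> in M. (\<lambda>n. x n \<omega>) \<longlonglongrightarrow> xstar \<omega>"
    "\<And>n. integrable M (\<lambda>\<omega>. dist (x n \<omega>) (xstar \<omega>))"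
    "\<And>n. expectation (\<lambda>\<omega>. dist (x n \<omega>) (xstar \<omega>)) \<le> C * sqrt q ^ n"
proof -
  obtain s0 where s0: "s0 \<in> S" using S_ne by blast
  define d where "d n \<omega> = dist (x n \<omega>) (x (Suc n) \<omega>)" for n \<omega>
  have d_int: "integrable M (d n)" for n unfolding d_def by (rule integrable_increment)
  have d_m[measurable]: "d n \<in> borel_measurable M" for n using d_int by auto
  have \<Phi>_m[measurable]: "(\<lambda>\<omega>. \<Phi> (x n \<omega>)) \<in> borel_measurable M" for n using integrable_fun by auto
  have d_nonneg: "0 \<le> d n \<omega>" for n \<omega> by (simp add: d_def)
  define r where "r = sqrt q"
  have r: "0 \<le> r" "r < 1" using q by (auto simp: r_def)
  define A where "A = sqrt (B * \<Phi> x0)"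
  have A: "0 \<le> A" using B \<Phi>_nonneg[OF x0_K] by (simp add: A_def)
  have d_le: "(\<integral>\<^sup>+\<omega>. ennreal (d n \<omega>) \<partial>M) \<le> ennreal (A * r ^ n)" for n
    using expectation_increment[of n, folded d_def A_def r_def] d_int[of n] d_nonneg
    by (subst nn_integral_eq_integral) (auto intro!: ennreal_leI)
  have \<Phi>_le: "(\<integral>\<^sup>+\<omega>. ennreal (\<Phi> (x n \<omega>)) \<partial>M) \<le> ennreal (\<Phi> x0 * q ^ n)" for n
    using expectation_le_power[of n] integrable_fun[of \<Phi> n] \<Phi>_nonneg x_K
    by (subst nn_integral_eq_integral) (auto simp: mult.commute intro!: ennreal_leI)
  \<comment> \<open>Finiteness of this single variable encodes convergence of both series.\<close>
  define Z where "Z \<omega> = (\<Sum>n. ennreal (d n \<omega>)) + (\<Sum>n. ennreal (\<Phi> (x n \<omega>)))" for \<omega>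
  have Z_m[measurable]: "Z \<in> borel_measurable M" unfolding Z_def by measurable
  have tail: "(\<Sum>k. ennreal (a * b ^ (k + n))) = ennreal (a * b ^ n / (1 - b))"
    if "0 \<le> a" "0 \<le> b" "b < 1" for a b :: real and n
  proof (rule suminf_ennreal_eq)
    have "(\<lambda>k. b ^ k) sums (1 / (1 - b))" using that by (intro geometric_sums) auto
    from sums_mult[OF this, of "a * b ^ n"] show "(\<lambda>k. a * b ^ (k + n)) sums (a * b ^ n / (1 - b))"
      by (simp add: power_add mult_ac)
  qed (use that in auto)
  have "(\<integral>\<^sup>+\<omega>. Z \<omega> \<partial>M) = (\<Sum>n. \<integral>\<^sup>+\<omega>. ennreal (d n \<omega>) \<partial>M) + (\<Sum>n. \<integral>\<^sup>+\<omega>. ennreal (\<Phi> (x n \<omega>)) \<partial>M)"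
    unfolding Z_def by (subst nn_integral_add) (auto simp: nn_integral_suminf)
  also have "\<dots> \<le> (\<Sum>n. ennreal (A * r ^ n)) + (\<Sum>n. ennreal (\<Phi> x0 * q ^ n))"
    by (intro add_mono suminf_le d_le \<Phi>_le summableI)
  also have "\<dots> < \<infinity>"
    using tail[OF A r, of 0] tail[OF \<Phi>_nonneg[OF x0_K] q, of 0] by simp
  finally have "AE \<omega> in M. Z \<omega> \<noteq> \<infinity>" by (intro nn_integral_PInf_AE) auto
  \<comment> \<open>Replacing the path by a constant in \<open>S\<close> on the exceptional null
    event makes the limit exist, measurably and inside \<open>S\<close>, at every point of the
    space.\<close>
  define y where "y n \<omega> = (if Z \<omega> \<noteq> \<infinity> then x n \<omega> else s0)" for n \<omega>
  have dist_sum: "dist (x n \<omega>) (x (n + k) \<omega>) \<le> (\<Sum>j<k. d (j + n) \<omega>)" for n k \<omega>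
  proof (induction k)
    case (Suc k)
    have "dist (x n \<omega>) (x (n + Suc k) \<omega>) \<le> dist (x n \<omega>) (x (n + k) \<omega>) + d (n + k) \<omega>"
      unfolding d_def using dist_triangle by simp
    then show ?case using Suc by (simp add: add.commute)
  qed simp
  have lim: "\<exists>z\<in>S. (\<lambda>n. x n \<omega>) \<longlonglongrightarrow> z" if \<omega>: "\<omega> \<in> space M" "Z \<omega> \<noteq> \<infinity>" for \<omega>
  proof (rule limit_in_S)
    show "x k \<omega> \<in> K" for k using x_K \<omega> by blast
    have "(\<Sum>n. ennreal (d n \<omega>)) \<noteq> top" "(\<Sum>n. ennreal (\<Phi> (x n \<omega>))) \<noteq> top"
      using \<omega>(2) unfolding Z_def by auto
    then have sm: "summable (\<lambda>n. d n \<omega>)" "summable (\<lambda>n. \<Phi> (x n \<omega>))"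
      using d_nonneg \<Phi>_nonneg x_K \<omega>(1) by (auto intro!: summable_suminf_not_top)
    show "(\<lambda>k. \<Phi> (x k \<omega>)) \<longlonglongrightarrow> 0" using sm(2) by (rule summable_LIMSEQ_zero)
    show "Cauchy (\<lambda>n. x n \<omega>)"
    proof (rule metric_CauchyI)
      fix e :: real assume "0 < e"
      then obtain N where N: "\<And>m n. m \<ge> N \<Longrightarrow> norm (\<Sum>j=m..<n. d j \<omega>) < e"
        using sm(1) unfolding summable_Cauchy by metis
      have le: "dist (x m \<omega>) (x n \<omega>) < e" if "N \<le> m" "m \<le> n" for m n
      proof -
        have "dist (x m \<omega>) (x n \<omega>) \<le> (\<Sum>j<n-m. d (j + m) \<omega>)" using dist_sum[of m \<omega> "n - m"] that by simp
        also have "\<dots> = (\<Sum>j=m..<n. d j \<omega>)"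
          using sum.shift_bounds_nat_ivl[of "\<lambda>j. d j \<omega>" 0 m "n - m"] that by (simp add: atLeast0LessThan)
        also have "\<dots> < e" using N[of m n] that by (simp add: abs_less_iff)
        finally show ?thesis .
      qed
      show "\<exists>N. \<forall>m\<ge>N. \<forall>n\<ge>N. dist (x m \<omega>) (x n \<omega>) < e"
        by (intro exI[of _ N] allI impI) (metis le dist_commute nle_le)
    qed
  qed
  have "\<exists>z\<in>S. (\<lambda>n. y n \<omega>) \<longlonglongrightarrow> z" if "\<omega> \<in> space M" for \<omega>
    using lim[OF that] s0 by (cases "Z \<omega> = \<infinity>") (auto simp: y_def)
  then obtain xstar where xstar: "\<And>\<omega>. \<omega> \<in> space M \<Longrightarrow> xstar \<omega> \<in> S"
    "\<And>\<omega>. \<omega> \<in> space M \<Longrightarrow> (\<lambda>n. y n \<omega>) \<longlonglongrightarrow> xstar \<omega>" by metis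
  have y_m: "y n \<in> borel_measurable M" for n
    unfolding y_def by (rule measurable_fun_x) measurable
  have xs_m[measurable]: "xstar \<in> borel_measurable M"
    using y_m xstar(2) by (rule borel_measurable_LIMSEQ_metric)
  have dist_m[measurable]: "(\<lambda>\<omega>. dist (x n \<omega>) (xstar \<omega>)) \<in> borel_measurable M" for n
    by (rule measurable_fun_x)
      (intro borel_measurable_continuous_onI[THEN measurable_compose[OF xs_m]] continuous_intros)
  have conv: "AE \<omega> in M. (\<lambda>n. x n \<omega>) \<longlonglongrightarrow> xstar \<omega>"
    using \<open>AE \<omega> in M. Z \<omega> \<noteq> \<infinity>\<close> AE_space
  proof eventually_elim
    case (elim \<omega>)
    then show ?case using xstar(2)[of \<omega>] by (simp add: y_def)
  qed
  have bound: "(\<integral>\<^sup>+\<omega>. ennreal (dist (x n \<omega>) (xstar \<omega>)) \<partial>M) \<le> ennreal (A * r ^ n / (1 - r))" for n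
  proof -
    have "(\<integral>\<^sup>+\<omega>. ennreal (dist (x n \<omega>) (xstar \<omega>)) \<partial>M) \<le> (\<integral>\<^sup>+\<omega>. (\<Sum>k. ennreal (d (k + n) \<omega>)) \<partial>M)"
    proof (rule nn_integral_mono_AE, use conv in eventually_elim)
      case (elim \<omega>)
      \<comment> \<open>Letting \<open>k\<close> grow in \<open>dist_sum\<close> bounds the distance
        to the limit by the whole tail of increments.\<close>
      have "(\<lambda>k. ennreal (dist (x n \<omega>) (x (n + k) \<omega>))) \<longlonglongrightarrow> ennreal (dist (x n \<omega>) (xstar \<omega>))"
        using LIMSEQ_ignore_initial_segment[OF elim, of n]
        by (intro tendsto_ennrealI tendsto_intros) (simp add: add.commute)
      moreover have "ennreal (dist (x n \<omega>) (x (n + k) \<omega>)) \<le> (\<Sum>k. ennreal (d (k + n) \<omega>))" for k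
      proof -
        have "ennreal (dist (x n \<omega>) (x (n + k) \<omega>)) \<le> ennreal (\<Sum>j<k. d (j + n) \<omega>)"
          by (intro ennreal_leI dist_sum)
        also have "\<dots> = (\<Sum>j<k. ennreal (d (j + n) \<omega>))" using d_nonneg by (intro sum_ennreal[symmetric])
        also have "\<dots> \<le> (\<Sum>k. ennreal (d (k + n) \<omega>))" by (intro sum_le_suminf) auto
        finally show ?thesis .
      qed
      ultimately show ?case by (intro LIMSEQ_le_const2[OF _ exI[of _ 0]]) blast+
    qed
    also have "\<dots> = (\<Sum>k. \<integral>\<^sup>+\<omega>. ennreal (d (k + n) \<omega>) \<partial>M)" by (rule nn_integral_suminf) simp
    also have "\<dots> \<le> (\<Sum>k. ennreal (A * r ^ (k + n)))" by (intro suminf_le d_le summableI)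
    also have "\<dots> = ennreal (A * r ^ n / (1 - r))" by (rule tail[OF A r])
    finally show ?thesis .
  qed
  have int: "integrable M (\<lambda>\<omega>. dist (x n \<omega>) (xstar \<omega>))" for n
    using bound[of n] by (intro integrableI_bounded) (auto simp: le_less_trans)
  have "expectation (\<lambda>\<omega>. dist (x n \<omega>) (xstar \<omega>)) \<le> A / (1 - r) * sqrt q ^ n" for n
    using bound[of n] int[of n] A r
    by (subst (asm) nn_integral_eq_integral) (auto simp: r_def[symmetric] ennreal_le_iff)
  then show thesis using that[of xstar] xs_m xstar(1) conv int by blast
qed

end

section \<open>The convergence theorem\<close>

theorem theorem4p19:
  fixes V :: "'m::finite \<Rightarrow> 'a::real_inner set"
    and H :: "('a ^ 'm) set"
    and f :: "'a ^ 'm \<Rightarrow> real"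
    and h :: "'m \<Rightarrow> 'a \<Rightarrow> ereal"
    and F :: "'a ^ 'm \<Rightarrow> ereal"
    and M :: "'w measure"
    and \<epsilon> :: "'w \<Rightarrow> 'm \<Rightarrow> bool"
    and eps :: "nat \<Rightarrow> 'w \<Rightarrow> 'm \<Rightarrow> bool"
    and p \<nu> \<gamma> :: "'m \<Rightarrow> real"
    and x0 :: "'a ^ 'm"
    and c \<delta> pmin q Fmin :: real
    and S :: "('a ^ 'm) set"
    and x xtilde :: "nat \<Rightarrow> 'w \<Rightarrow> 'a ^ 'm"
  assumes "\<And>i. separable_hilbert (V i)"
    and H: "H = direct_sum V"
    and "convex_on H f"
    and "\<And>y. y \<in> H \<Longrightarrow> f differentiable (at y within H)"
    and "\<And>i. proper_on (V i) (h i)"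
    and "\<And>i. ereal_convex_on (V i) (h i)"
    and "\<And>i. lsc_on (V i) (h i)"
    and F: "\<And>y. F y = ereal (f y) + (\<Sum>i\<in>UNIV. h i (y $ i))"
    and "prob_space M"
    and "\<epsilon> \<in> measurable M (count_space UNIV)"
    and p: "\<And>i. p i = measure M {\<omega> \<in> space M. \<epsilon> \<omega> i}"
    and "\<And>i. 0 < p i"
    and "measure M {\<omega> \<in> space M. \<forall>i. \<not> \<epsilon> \<omega> i} = 0"
    and "prob_space.indep_vars M (\<lambda>_. count_space UNIV) eps UNIV"
    and "\<And>n. distr M (count_space UNIV) (eps n) = distr M (count_space UNIV) \<epsilon>"
    and "\<And>i. 0 < \<nu> i"
    and "\<And>y v. y \<in> H \<Longrightarrow> v \<in> H \<Longrightarrow>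
           (\<integral>\<omega>. f (y + \<epsilon> \<omega> \<odot> v) \<partial>M)
             \<le> f y + (\<integral>\<omega>. gradient_on H f y \<bullet> (\<epsilon> \<omega> \<odot> v) \<partial>M)
               + 1/2 * (\<Sum>i\<in>UNIV. p i * \<nu> i * (norm (v $ i))\<^sup>2)"
    and "\<And>i. 0 < \<gamma> i" and "\<And>i. \<gamma> i < 2 / \<nu> i"
    and "x0 \<in> H" and "(\<Sum>i\<in>UNIV. h i (x0 $ i)) < \<infinity>"
    and \<delta>: "\<delta> = (MAX i. \<gamma> i * \<nu> i)"
    and pmin: "pmin = (MIN i. p i)"
    and Fmin: "Fmin = real_of_ereal (INF y\<in>H. F y)"
    and S: "S = argmin_on H F"
    and "S \<noteq> {}"
    and "0 < c"
    and "\<And>y. y \<in> H \<Longrightarrow> F y \<le> F x0 \<Longrightarrow>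
           wdist (\<lambda>i. 1 / \<gamma> i) y S \<le> c * wnorm (\<lambda>i. 1 / \<gamma> i) (y - fb_step V f h \<gamma> y)"
    and "\<And>\<omega>. \<omega> \<in> space M \<Longrightarrow> x 0 \<omega> = x0"
    and "\<And>n \<omega>. \<omega> \<in> space M \<Longrightarrow>
           xtilde (Suc n) \<omega> = x n \<omega> + eps n \<omega> \<odot> (fb_step V f h \<gamma> (x n \<omega>) - x n \<omega>)"
    and "\<And>n \<omega>. \<omega> \<in> space M \<Longrightarrow>
           x (Suc n) \<omega> = (if F (xtilde (Suc n) \<omega>) \<le> F (x n \<omega>) then xtilde (Suc n) \<omega> else x n \<omega>)"
    and q: "q = 1 - pmin * min 1 ((2 - \<delta>) / (2 * c))"
  shows "(\<forall>n. (\<forall>\<omega>\<in>space M. \<bar>F (x n \<omega>)\<bar> \<noteq> \<infinity>)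
            \<and> integrable M (\<lambda>\<omega>. real_of_ereal (F (x n \<omega>)))
            \<and> (\<integral>\<omega>. real_of_ereal (F (x n \<omega>)) \<partial>M) - Fmin
                \<le> q ^ n * ((\<integral>\<omega>. real_of_ereal (F (x 0 \<omega>)) \<partial>M) - Fmin))
       \<and> (\<exists>xstar. xstar \<in> borel_measurable M
            \<and> (\<forall>\<omega>\<in>space M. xstar \<omega> \<in> S)
            \<and> (AE \<omega> in M. (\<lambda>n. x n \<omega>) \<longlonglongrightarrow> xstar \<omega>)
            \<and> (\<forall>n. integrable M (\<lambda>\<omega>. wnorm (\<lambda>i. 1 / (\<gamma> i * p i)) (x n \<omega> - xstar \<omega>)))
            \<and> (\<lambda>n. \<integral>\<omega>. wnorm (\<lambda>i. 1 / (\<gamma> i * p i)) (x n \<omega> - xstar \<omega>) \<partial>M)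
                \<in> O(\<lambda>n. q powr (real n / 2)))"
proof -
  interpret prob_space M by fact
  define P where "P e = prob {\<omega> \<in> space M. \<epsilon> \<omega> = e}" for e
  have \<epsilon>_m: "\<epsilon> \<in> measurable M (count_space UNIV)" by fact
  have eps_m: "eps n \<in> measurable M (count_space UNIV)" for n
    using \<open>indep_vars (\<lambda>_. count_space UNIV) eps UNIV\<close> by (simp add: indep_vars_def2)
  have P_eps: "prob {\<omega> \<in> space M. eps n \<omega> = e} = P e" for n e
  proof -
    have "measure (distr M (count_space UNIV) (eps n)) {e} = measure (distr M (count_space UNIV) \<epsilon>) {e}"
      using \<open>\<And>n. distr M (count_space UNIV) (eps n) = distr M (count_space UNIV) \<epsilon>\<close> by simp
    then show ?thesis
      by (simp add: measure_distr[OF eps_m] measure_distr[OF \<epsilon>_m] P_def vimage_def Int_def conj_commute)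
  qed
  \<comment> \<open>Reduces every expectation over a mask to the finite sums used in the
    deterministic locale.\<close>
  have E\<epsilon>: "(\<integral>\<omega>. g (\<epsilon> \<omega>) \<partial>M) = (\<Sum>e\<in>UNIV. P e * g e)" for g :: "('m \<Rightarrow> bool) \<Rightarrow> real"
    unfolding P_def by (rule expectation_finite_type[OF \<epsilon>_m])
  have marginal: "(\<Sum>e\<in>UNIV. P e * of_bool (e i)) = p i" for i
  proof -
    have "{\<omega> \<in> space M. \<epsilon> \<omega> i} \<in> events"
      using measurable_sets[OF \<epsilon>_m, of "{e. e i}"] by (simp add: vimage_def Int_def conj_commute)
    then have "p i = (\<integral>\<omega>. indicator {\<omega> \<in> space M. \<epsilon> \<omega> i} \<omega> \<partial>M)" by (simp add: p Int_absorb2)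
    also have "\<dots> = (\<integral>\<omega>. of_bool (\<epsilon> \<omega> i) \<partial>M)"
      by (rule Bochner_Integration.integral_cong) (auto simp: indicator_def)
    also have "\<dots> = (\<Sum>e\<in>UNIV. P e * of_bool (e i))" by (rule E\<epsilon>)
    finally show ?thesis by simp
  qed
  interpret B: block_prox_gradient V f h P p \<nu> \<gamma>
  proof
    show "Topological_Spaces.complete (V i)" "subspace (V i)" for i
      using \<open>\<And>i. separable_hilbert (V i)\<close> by (auto simp: separable_hilbert_def)
    show "0 \<le> P e" for e by (simp add: P_def)
    show "(\<Sum>e\<in>UNIV. P e) = 1" using E\<epsilon>[of "\<lambda>_. 1"] by (simp add: prob_space)
    show "(\<Sum>e\<in>UNIV. P e * f (y + e \<odot> v))
        \<le> f y + (\<Sum>i\<in>UNIV. p i * (gradient_on (direct_sum V) f y $ i \<bullet> v $ i))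
          + 1/2 * (\<Sum>i\<in>UNIV. p i * \<nu> i * (norm (v $ i))\<^sup>2)"
      if yv: "y \<in> direct_sum V" "v \<in> direct_sum V" for y v
    proof -
      let ?g = "gradient_on H f y"
      have "(\<integral>\<omega>. ?g \<bullet> (\<epsilon> \<omega> \<odot> v) \<partial>M) = (\<Sum>e\<in>UNIV. P e * (?g \<bullet> (e \<odot> v)))" by (rule E\<epsilon>)
      also have "\<dots> = (\<Sum>e\<in>UNIV. \<Sum>i\<in>UNIV. P e * of_bool (e i) * (?g $ i \<bullet> v $ i))"
        unfolding inner_vec_def sum_distrib_left by (intro sum.cong refl) (simp add: mask_def)
      also have "\<dots> = (\<Sum>i\<in>UNIV. p i * (?g $ i \<bullet> v $ i))"
        by (subst sum.swap) (simp add: marginal flip: sum_distrib_right)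
      finally show ?thesis
        using assms(17)[of y v] yv E\<epsilon>[of "\<lambda>e. f (y + e \<odot> v)"] by (simp add: H)
    qed
    show "(\<Sum>e\<in>UNIV. P e * of_bool (e i)) = p i" for i by (rule marginal)
  qed (use assms in simp_all)
  have F_B: "F = B.F" by (rule ext) (simp add: F B.F_def)
  have \<delta>_B: "\<delta> = B.\<delta>" and pmin_B: "pmin = B.pmin" by (simp_all add: \<delta> pmin B.\<delta>_def B.pmin_def)

  \<comment> \<open>Minimizers, the initial sublevel set and the accepted step\<close>
  let ?T = "fb_step V f h \<gamma>"
  have x0_dom: "x0 \<in> B.domF"
    using \<open>x0 \<in> H\<close> \<open>(\<Sum>i\<in>UNIV. h i (x0 $ i)) < \<infinity>\<close>
    by (auto simp: B.domF_def H direct_sum_def sum_Pinfty)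
  \<comment> \<open>The set on which the error bound is assumed. As \<open>F x0\<close> is finite,
    it lies in \<open>domF\<close>, where real values may be used.\<close>
  define K where "K = {y \<in> H. F y \<le> F x0}"
  have K_dom: "y \<in> B.domF" if "y \<in> K" for y
    by (rule ccontr) (use that B.F_infinite[of y] B.F_Fr[OF x0_dom] in \<open>auto simp: K_def H F_B\<close>)
  have F_Fr: "F y = ereal (B.Fr y)" if "y \<in> B.domF" for y
    unfolding F_B by (rule B.F_Fr[OF that])
  have S_iff: "z \<in> S \<longleftrightarrow> z \<in> H \<and> (\<forall>y\<in>H. F z \<le> F y)" for z
    by (auto simp: S argmin_on_def is_arg_min_def not_less)
  have S_props: "z \<in> B.domF" "B.Fr z = Fmin" if z: "z \<in> S" for z
  proof -
    \<comment> \<open>A minimizer has value at most \<open>F x0\<close>, hence finite, and attains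
      the infimum; so \<open>Fmin\<close> is a true value of \<open>F\<close> and not a default of
      \<open>real_of_ereal\<close>.\<close>
    have "z \<in> K" using z \<open>x0 \<in> H\<close> by (simp add: S_iff K_def)
    then show dom: "z \<in> B.domF" by (rule K_dom)
    have "(INF y\<in>H. F y) = F z"
      using z by (intro antisym INF_lower INF_greatest) (auto simp: S_iff)
    then show "B.Fr z = Fmin" by (simp add: Fmin F_Fr[OF dom])
  qed
  obtain s0 where s0: "s0 \<in> S" using \<open>S \<noteq> {}\<close> by blast
  have Fmin_le: "Fmin \<le> B.Fr y" if "y \<in> B.domF" for y
    using s0 S_props[OF s0] F_Fr[OF S_props(1)[OF s0]] F_Fr[OF that] B.domF_H[OF that]
    by (auto simp: S_iff H)
  \<comment> \<open>Trial step and acceptance test in one map of mask and state; the test keeps the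
    iterates in \<open>K\<close>.\<close>
  define G where "G e y = (let t = y + e \<odot> (?T y - y) in if F t \<le> F y then t else y)" for e y
  have G_K: "G e y \<in> K" if y: "y \<in> K" for e y
    using y B.domF_H[OF B.masked_step_domF[OF K_dom[OF y]], of e] order_trans[of _ "F y" "F x0"]
    by (auto simp: G_def Let_def K_def H)
  define \<Phi> where "\<Phi> y = real_of_ereal (F y) - Fmin" for y
  have \<Phi>: "\<Phi> y = B.Fr y - Fmin" if "y \<in> B.domF" for y
    by (simp add: \<Phi>_def F_Fr[OF that])
  \<comment> \<open>Whether the trial is accepted or rejected, the new value is at most the trial
    value, so the test preserves the contraction.\<close>
  have \<Phi>_G: "\<Phi> (G e y) \<le> B.Fr (y + e \<odot> (?T y - y)) - Fmin" if y: "y \<in> K" for e y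
    using \<Phi>[OF K_dom[OF y]] \<Phi>[OF B.masked_step_domF[OF K_dom[OF y]]]
      F_Fr[OF K_dom[OF y]] F_Fr[OF B.masked_step_domF[OF K_dom[OF y]]]
    by (auto simp: G_def Let_def)
  have \<theta>: "0 < min 1 ((2 - \<delta>) / (2 * c))" "min 1 ((2 - \<delta>) / (2 * c)) \<le> 1"
    using B.\<delta>_less \<open>0 < c\<close> by (auto simp: \<delta>_B)
  have q_bounds: "0 \<le> q" "q < 1"
    using \<theta> B.pmin_pos B.pmin_le_1 mult_le_one[of pmin "min 1 ((2 - \<delta>) / (2 * c))"]
      mult_pos_pos[of pmin "min 1 ((2 - \<delta>) / (2 * c))"] by (auto simp: q pmin_B)
  define Bd where "Bd = 2 / (2 - \<delta>) * (\<Sum>i\<in>UNIV. \<gamma> i)"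
  interpret D: random_descent M eps P G x x0 K S \<Phi> q Bd
  proof
    show "indep_vars (\<lambda>_. count_space UNIV) eps UNIV" by fact
    show "prob {\<omega> \<in> space M. eps n \<omega> = e} = P e" for n e by (rule P_eps)
    show "x 0 \<omega> = x0" if "\<omega> \<in> space M" for \<omega> using assms(29) that .
    show "x (Suc n) \<omega> = G (eps n \<omega>) (x n \<omega>)" if "\<omega> \<in> space M" for n \<omega>
      using assms(30,31)[OF that, of n] by (simp add: G_def Let_def)
    show "x0 \<in> K" using \<open>x0 \<in> H\<close> by (simp add: K_def)
    show "G e y \<in> K" if "y \<in> K" for e y by (rule G_K[OF that])
    show "0 \<le> \<Phi> y" if "y \<in> K" for y using \<Phi> Fmin_le K_dom[OF that] by simp
    show "(\<Sum>e\<in>UNIV. P e * \<Phi> (G e y)) \<le> q * \<Phi> y" if y: "y \<in> K" for y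
    proof -
      have "(\<Sum>e\<in>UNIV. P e * \<Phi> (G e y)) \<le> (\<Sum>e\<in>UNIV. P e * (B.Fr (y + e \<odot> (?T y - y)) - Fmin))"
        by (intro sum_mono mult_left_mono \<Phi>_G y B.P_nonneg)
      also have "\<dots> \<le> (1 - B.pmin * min 1 ((2 - B.\<delta>) / (2 * c))) * (B.Fr y - Fmin)"
        using assms(28)[of y] y S_props
        by (intro B.expected_contraction[OF K_dom[OF y] \<open>S \<noteq> {}\<close> _ \<open>0 < c\<close>]) (auto simp: K_def)
      finally show ?thesis by (simp add: q pmin_B \<delta>_B \<Phi>[OF K_dom[OF y]])
    qed
    show "(\<Sum>e\<in>UNIV. P e * (dist y (G e y))\<^sup>2) \<le> Bd * \<Phi> y" if y: "y \<in> K" for y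
    proof -
      \<comment> \<open>The actual move is either the masked step or zero.\<close>
      have "dist y (G e y) \<le> norm (e \<odot> (?T y - y))" for e
        by (simp add: G_def Let_def dist_norm)
      then have "(\<Sum>e\<in>UNIV. P e * (dist y (G e y))\<^sup>2) \<le> (\<Sum>e\<in>UNIV. P e * (norm (e \<odot> (?T y - y)))\<^sup>2)"
        by (intro sum_mono mult_left_mono power_mono B.P_nonneg) auto
      also have "\<dots> \<le> Bd * \<Phi> y"
        unfolding Bd_def \<delta>_B \<Phi>[OF K_dom[OF y]]
        by (rule B.expected_step_bound[OF K_dom[OF y] Fmin_le])
      finally show ?thesis .
    qed
    show "0 \<le> q" "q < 1" by (fact q_bounds)+
    show "0 \<le> Bd" using B.\<delta>_less B.\<gamma>_pos
      unfolding Bd_def \<delta>_B by (intro mult_nonneg_nonneg sum_nonneg) (auto simp: less_imp_le)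
    \<comment> \<open>Completeness of \<open>H\<close> gives the limit, and lower semicontinuity of
      \<open>F\<close> bounds its value by the minimum.\<close>
    show "\<exists>z\<in>S. s \<longlonglongrightarrow> z"
      if s: "\<And>k. s k \<in> K" and C: "Cauchy s" and lim: "(\<lambda>k. \<Phi> (s k)) \<longlonglongrightarrow> 0" for s
    proof -
      have sH: "\<forall>k. s k \<in> B.H" using s by (simp add: K_def H)
      then obtain z where z: "s \<longlonglongrightarrow> z" using B.complete_H C unfolding complete_def by blast
      have dom: "s k \<in> B.domF" for k by (rule K_dom[OF s])
      have "(\<lambda>k. \<Phi> (s k) + Fmin) \<longlonglongrightarrow> 0 + Fmin" by (intro tendsto_intros lim)
      then have Fr_lim: "(\<lambda>k. B.Fr (s k)) \<longlonglongrightarrow> Fmin" by (simp add: \<Phi>[OF dom])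
      have z_dom: "z \<in> B.domF" and z_le: "B.Fr z \<le> Fmin" using B.Fr_lsc[OF dom z Fr_lim] by auto
      have "F z \<le> F s0" using z_le by (simp add: F_Fr z_dom S_props[OF s0])
      then have "z \<in> S" using s0 B.domF_H[OF z_dom] by (auto simp: S_iff H intro: order_trans)
      then show ?thesis using z by blast
    qed
    show "S \<noteq> {}" by fact
  qed

  \<comment> \<open>Rate for the values and rate in the weighted norm\<close>
  have int: "integrable M (\<lambda>\<omega>. real_of_ereal (F (x n \<omega>)))" for n
    by (rule D.integrable_fun)
  have fin: "\<bar>F (x n \<omega>)\<bar> \<noteq> \<infinity>" if "\<omega> \<in> space M" for n \<omega>
    using F_Fr[OF K_dom[OF D.x_K[OF that]]] by simp
  have rate: "(\<integral>\<omega>. real_of_ereal (F (x n \<omega>)) \<partial>M) - Fmin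
    \<le> q ^ n * ((\<integral>\<omega>. real_of_ereal (F (x 0 \<omega>)) \<partial>M) - Fmin)" for n
  proof -
    have "(\<integral>\<omega>. real_of_ereal (F (x n \<omega>)) \<partial>M) - Fmin = (\<integral>\<omega>. \<Phi> (x n \<omega>) \<partial>M)"
      unfolding \<Phi>_def using int[of n] by (simp add: prob_space)
    also have "\<dots> \<le> q ^ n * \<Phi> x0" by (rule D.expectation_le_power)
    also have "\<Phi> x0 = (\<integral>\<omega>. real_of_ereal (F (x 0 \<omega>)) \<partial>M) - Fmin"
    proof -
      have "(\<integral>\<omega>. real_of_ereal (F (x 0 \<omega>)) \<partial>M) = (\<integral>\<omega>. real_of_ereal (F x0) \<partial>M)"
        by (rule Bochner_Integration.integral_cong) (auto simp: D.x_0)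
      then show ?thesis by (simp add: \<Phi>_def prob_space)
    qed
    finally show ?thesis .
  qed
  obtain xstar C where xs: "xstar \<in> borel_measurable M" "\<And>\<omega>. \<omega> \<in> space M \<Longrightarrow> xstar \<omega> \<in> S"
    "AE \<omega> in M. (\<lambda>n. x n \<omega>) \<longlonglongrightarrow> xstar \<omega>"
    "\<And>n. integrable M (\<lambda>\<omega>. dist (x n \<omega>) (xstar \<omega>))"
    "\<And>n. (\<integral>\<omega>. dist (x n \<omega>) (xstar \<omega>) \<partial>M) \<le> C * sqrt q ^ n"
    using D.convergence by blast
  let ?W = "\<lambda>i. 1 / (\<gamma> i * p i)"
  define \<kappa> where "\<kappa> = sqrt (\<Sum>i\<in>UNIV. ?W i)"
  have W: "0 \<le> ?W i" for i using B.\<gamma>_pos[of i] B.p_pos[of i] by simp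
  have \<kappa>: "0 \<le> \<kappa>" unfolding \<kappa>_def by (intro real_sqrt_ge_zero sum_nonneg W)
  have W_le: "wnorm ?W (x n \<omega> - xstar \<omega>) \<le> \<kappa> * dist (x n \<omega>) (xstar \<omega>)" for n \<omega>
    unfolding dist_norm \<kappa>_def by (rule wnorm_le_norm[OF W])
  have W_nonneg: "0 \<le> wnorm ?W v" for v :: "'a ^ 'm" by (rule wnorm_nonneg[OF W])
  have W_m: "(\<lambda>\<omega>. wnorm ?W (x n \<omega> - xstar \<omega>)) \<in> borel_measurable M" for n
  proof (rule D.measurable_fun_x)
    fix y :: "'a ^ 'm"
    have "continuous_on UNIV (\<lambda>u. wnorm ?W (y - u))"
      by (rule continuous_on_compose2[OF continuous_on_wnorm[of UNIV]]) (auto intro!: continuous_intros)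
    then show "(\<lambda>\<omega>. wnorm ?W (y - xstar \<omega>)) \<in> borel_measurable M"
      using xs(1) by (rule borel_measurable_continuous_on)
  qed
  have W_int: "integrable M (\<lambda>\<omega>. wnorm ?W (x n \<omega> - xstar \<omega>))" for n
    by (rule Bochner_Integration.integrable_bound[OF integrable_mult_right[OF xs(4), of \<kappa> n] W_m])
      (use W_le W_nonneg \<kappa> in \<open>auto simp: abs_mult intro!: AE_I2\<close>)
  have W_exp: "(\<integral>\<omega>. wnorm ?W (x n \<omega> - xstar \<omega>) \<partial>M) \<le> \<kappa> * C * sqrt q ^ n" for n
  proof -
    have "(\<integral>\<omega>. wnorm ?W (x n \<omega> - xstar \<omega>) \<partial>M) \<le> (\<integral>\<omega>. \<kappa> * dist (x n \<omega>) (xstar \<omega>) \<partial>M)"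
      by (intro integral_mono W_int integrable_mult_right xs(4) W_le)
    also have "\<dots> \<le> \<kappa> * (C * sqrt q ^ n)" using xs(5)[of n] \<kappa> by (simp add: mult_left_mono)
    finally show ?thesis by (simp add: mult.assoc)
  qed
  \<comment> \<open>The case \<open>n = 0\<close> is excluded because \<open>0 powr 0 = 0\<close>
    whereas \<open>sqrt 0 ^ 0 = 1\<close>; the asymptotic bound only concerns large
    \<open>n\<close>.\<close>
  have powr: "sqrt q ^ n = q powr (real n / 2)" if "0 < n" for n
  proof (cases "q = 0")
    case False
    then have "sqrt q ^ n = (q powr (1/2)) powr real n"
      using q_bounds by (simp add: powr_half_sqrt powr_realpow)
    then show ?thesis by (simp add: powr_powr)
  qed (use that in simp)
  have bigo: "(\<lambda>n. \<integral>\<omega>. wnorm ?W (x n \<omega> - xstar \<omega>) \<partial>M) \<in> O(\<lambda>n. q powr (real n / 2))"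
  proof (rule bigoI)
    show "\<forall>\<^sub>F n in sequentially. norm (\<integral>\<omega>. wnorm ?W (x n \<omega> - xstar \<omega>) \<partial>M)
      \<le> \<kappa> * C * norm (q powr (real n / 2))"
      using eventually_gt_at_top[of 0]
    proof eventually_elim
      case (elim n)
      then show ?case using W_exp[of n] W_nonneg by (simp add: powr[OF elim])
    qed
  qed
  show ?thesis
    by (intro conjI allI ballI exI[of _ xstar] int fin rate xs(1-3) W_int bigo)
qed

end
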